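(* Let $n\ge1$ be an integer, let $F\in\mathbb{C}[x_1,\ldots,x_s]$ and let $p\in X=\mathbf{V}(F)\subset\mathbb{C}^s$ be a non-singular point. Then $$T^n_pX=\ker\mathrm{Jac}_n(F)_{|p}$$ as subspaces of $\mathbb{C}^{N-1}$, where $N=\binom{n+s}{s}$.
   Context: Let $R=\mathbb{C}[x_1,\ldots,x_s]/\langle F\rangle$, $(R_p,\mathfrak{m}_p)$ its localization at $p$, and $T^n_pX:=(\mathfrak{m}_p/\mathfrak{m}_p^{n+1})^{\vee}$ (dual of a vector space over $R_p/\mathfrak{m}_p\cong\mathbb{C}$). Since $X\subset\mathbb{C}^s$, $T^n_pX$ is a subspace of $T^n_p\mathbb{C}^s=(\mathfrak{a}_p/\mathfrak{a}_p^{n+1})^\vee$, where $\mathfrak{a}_p\subset\mathbb{C}[x_1,\ldots,x_s]$ is the maximal ideal of $p$. The latter is identified with $\mathbb{C}^{N-1}$ as follows: the map $\theta:\mathfrak{a}_p\to\mathbb{C}^{N-1}$, $f\mapsto\big(\frac{\partial^\alpha f}{\alpha!}(p)\,\big|\,1\le|\alpha|\le n\big)$ induces an isomorphism $\mathfrak{a}_p/\mathfrak{a}_p^{n+1}\cong\mathbb{C}^{N-1}$, and $\mathbb{C}^{N-1}$ is identified with its dual via $t\mapsto\sum_i t_ie_i^\vee$, where $e_i^\vee$ are the coordinate functionals. $\mathbb{N}=\{0,1,2,\ldots\}$. For $\alpha,\beta\in\mathbb{N}^s$: $|\alpha|=\alpha_1+\cdots+\alpha_s$, $\alpha!=\alpha_1!\cdots\alpha_s!$,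 $\binom{\alpha}{\beta}=\prod_i\binom{\alpha_i}{\beta_i}$, $\alpha\le\beta$ means $\alpha_i\le\beta_i$ for all $i$, and $\partial^\alpha=\partial^{\alpha_1}_{x_1}\cdots\partial^{\alpha_s}_{x_s}$. Convention: $\partial^{\alpha-\beta}F=0$ if $\alpha_i<\beta_i$ for some $i$. Multi-indices are ordered increasingly by graded lexicographical order with $x_1<x_2<\cdots<x_s$: $\alpha<_{grlex}\beta$ iff $|\alpha|<|\beta|$, or $|\alpha|=|\beta|$ and $\alpha_i<\beta_i$ for the largest index $i$ with $\alpha_i\neq\beta_i$. Let $M=\binom{n+s-1}{s}$. For $\beta\in\mathbb{N}^s$ with $0\le|\beta|\le n-1$ put $r_\beta:=\beta!\cdot\Big(\binom{\alpha}{\beta}\frac{\partial^{\alpha-\beta}F}{\alpha!}\ \Big|\ 1\le|\alpha|\le n\Big)$, a vector of $N-1$ polynomials with entries ordered increasingly in $\alpha$ by the graded lexicographical order $<_{grlex}$ (so its $\alpha$-entry is $\frac{\partial^{\alpha-\beta}F}{(\alpha-\beta)!}$ if $\alpha\ge\beta$ and $0$ otherwise). The Jacobian matrix of order $n$ of $F$, $\mathrm{Jac}_n(F)$, is the $M\times(N-1)$ matrix whose rows are the $M$ vectors $r_\beta$, ordered increasingly in $\beta$. $\mathrm{Jac}_n(F)_{|p}$ is the complex matrix obtained by evaluating the entries at $p$. *)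

theory Defs
  imports
    "HOL-Library.Poly_Mapping"
    "HOL-Library.Extended_Nat"
    "HOL-Library.Cardinality"
    "HOL-Algebra.Algebra"
    "Jordan_Normal_Form.Matrix_Kernel"
begin

section \<open>Polynomials and multi-indices\<close>

text \<open>
  The variables are indexed by a finite linearly ordered type \<open>'s\<close>; its order is the order
  \<open>x\<^sub>1 < \<dots> < x\<^sub>s\<close> of the variables and \<open>s = CARD('s)\<close>. A multi-index, equivalently a monomial, is
  an element of \<open>'s \<Rightarrow>\<^sub>0 nat\<close>; addition and (truncated) subtraction of multi-indices are pointwise.
  The library order \<open>\<le>\<close> on \<open>'s \<Rightarrow>\<^sub>0 nat\<close> is lexicographic and is not used here.
  Affine space is the function type \<open>'s \<Rightarrow> complex\<close>.
\<close>

type_synonym 's mindex = "'s \<Rightarrow>\<^sub>0 nat"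
type_synonym 's cpoly = "'s mindex \<Rightarrow>\<^sub>0 complex"

abbreviation mi :: "'s mindex \<Rightarrow> 's \<Rightarrow> nat" where
  "mi \<equiv> Poly_Mapping.lookup"

definition cpoly_const :: "complex \<Rightarrow> 's cpoly" where
  "cpoly_const c = Poly_Mapping.single 0 c"

definition cpoly_eval :: "('s::finite \<Rightarrow> complex) \<Rightarrow> 's cpoly \<Rightarrow> complex" where
  "cpoly_eval p f =
     (\<Sum>m\<in>Poly_Mapping.keys f. Poly_Mapping.lookup f m * (\<Prod>i\<in>UNIV. p i ^ mi m i))"

definition cpoly_pderiv :: "'s \<Rightarrow> 's cpoly \<Rightarrow> 's cpoly" where
  "cpoly_pderiv i f =
     (\<Sum>m\<in>Poly_Mapping.keys f.
        Poly_Mapping.single (m - Poly_Mapping.single i 1)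
          (of_nat (mi m i) * Poly_Mapping.lookup f m))"

definition cpoly_mderiv :: "'s::{finite,linorder} mindex \<Rightarrow> 's cpoly \<Rightarrow> 's cpoly" where
  "cpoly_mderiv \<alpha> f = foldr (\<lambda>i. cpoly_pderiv i ^^ mi \<alpha> i) (sorted_list_of_set UNIV) f"

definition mi_deg :: "'s::finite mindex \<Rightarrow> nat" where
  "mi_deg \<alpha> = (\<Sum>i\<in>UNIV. mi \<alpha> i)"

definition mi_fact :: "'s::finite mindex \<Rightarrow> nat" where
  "mi_fact \<alpha> = (\<Prod>i\<in>UNIV. fact (mi \<alpha> i))"

definition mi_choose :: "'s::finite mindex \<Rightarrow> 's mindex \<Rightarrow> nat" where
  "mi_choose \<alpha> \<beta> = (\<Prod>i\<in>UNIV. mi \<alpha> i choose mi \<beta> i)"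

definition mi_le :: "'s mindex \<Rightarrow> 's mindex \<Rightarrow> bool" where
  "mi_le \<beta> \<alpha> \<longleftrightarrow> (\<forall>i. mi \<beta> i \<le> mi \<alpha> i)"

definition grlex_less :: "'s::{finite,linorder} mindex \<Rightarrow> 's mindex \<Rightarrow> bool" where
  "grlex_less \<alpha> \<beta> \<longleftrightarrow>
     mi_deg \<alpha> < mi_deg \<beta> \<or>
     mi_deg \<alpha> = mi_deg \<beta> \<and> (\<exists>i. mi \<alpha> i < mi \<beta> i \<and> (\<forall>j>i. mi \<alpha> j = mi \<beta> j))"

text \<open>The multi-indices of degree between \<open>a\<close> and \<open>b\<close> in increasing graded lexicographic order.\<close>

definition mindices :: "nat \<Rightarrow> nat \<Rightarrow> 's::{finite,linorder} mindex list" where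
  "mindices a b =
     (THE as. sorted_wrt grlex_less as \<and> set as = {\<alpha>. a \<le> mi_deg \<alpha> \<and> mi_deg \<alpha> \<le> b})"


section \<open>The Jacobian matrix of order \<open>n\<close>\<close>

definition jac_entry :: "'s::{finite,linorder} cpoly \<Rightarrow> 's mindex \<Rightarrow> 's mindex \<Rightarrow> 's cpoly" where
  "jac_entry F \<beta> \<alpha> =
     cpoly_const (of_nat (mi_fact \<beta>) * of_nat (mi_choose \<alpha> \<beta>) / of_nat (mi_fact \<alpha>)) *
     (if mi_le \<beta> \<alpha> then cpoly_mderiv (\<alpha> - \<beta>) F else 0)"

definition Jac :: "nat \<Rightarrow> 's::{finite,linorder} cpoly \<Rightarrow> 's cpoly mat" where
  "Jac n F =
     mat ((n + CARD('s) - 1) choose CARD('s)) (((n + CARD('s)) choose CARD('s)) - 1)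
       (\<lambda>(i, j). jac_entry F (mindices 0 (n - 1) ! i) (mindices 1 n ! j))"

definition Jac_at :: "nat \<Rightarrow> 's::{finite,linorder} cpoly \<Rightarrow> ('s \<Rightarrow> complex) \<Rightarrow> complex mat" where
  "Jac_at n F p = map_mat (cpoly_eval p) (Jac n F)"


section \<open>Localization and regular local rings\<close>

text \<open>For a commutative ring \<open>R\<close> and a multiplicative subset \<open>S\<close>; the pair \<open>(a, s)\<close> stands for
  the fraction \<open>a / s\<close>.\<close>

definition frac_rel :: "('a, 'b) ring_scheme \<Rightarrow> 'a set \<Rightarrow> (('a \<times> 'a) \<times> ('a \<times> 'a)) set" where
  "frac_rel R S =
     {((a, s), (b, t)). a \<in> carrier R \<and> b \<in> carrier R \<and> s \<in> S \<and> t \<in> S \<and>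
        (\<exists>u\<in>S. u \<otimes>\<^bsub>R\<^esub> (t \<otimes>\<^bsub>R\<^esub> a \<ominus>\<^bsub>R\<^esub> s \<otimes>\<^bsub>R\<^esub> b) = \<zero>\<^bsub>R\<^esub>)}"

definition fraction :: "('a, 'b) ring_scheme \<Rightarrow> 'a set \<Rightarrow> 'a \<Rightarrow> 'a \<Rightarrow> ('a \<times> 'a) set" where
  "fraction R S a s = frac_rel R S `` {(a, s)}"

definition localization :: "('a, 'b) ring_scheme \<Rightarrow> 'a set \<Rightarrow> ('a \<times> 'a) set ring" where
  "localization R S =
     \<lparr> carrier = (carrier R \<times> S) // frac_rel R S,
       monoid.mult = (\<lambda>C D. \<Union>(a, s)\<in>C. \<Union>(b, t)\<in>D. fraction R S (a \<otimes>\<^bsub>R\<^esub> b) (s \<otimes>\<^bsub>R\<^esub> t)),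
       monoid.one = fraction R S \<one>\<^bsub>R\<^esub> \<one>\<^bsub>R\<^esub>,
       ring.zero = fraction R S \<zero>\<^bsub>R\<^esub> \<one>\<^bsub>R\<^esub>,
       ring.add = (\<lambda>C D. \<Union>(a, s)\<in>C. \<Union>(b, t)\<in>D.
                fraction R S (t \<otimes>\<^bsub>R\<^esub> a \<oplus>\<^bsub>R\<^esub> s \<otimes>\<^bsub>R\<^esub> b) (s \<otimes>\<^bsub>R\<^esub> t)) \<rparr>"

definition krull_dim :: "('a, 'b) ring_scheme \<Rightarrow> enat" where
  "krull_dim A =
     (SUP k \<in> {k. \<exists>P. (\<forall>i\<le>k. primeideal (P i) A) \<and> (\<forall>i<k. P i \<subset> P (Suc i))}. enat k)"

definition min_gens :: "('a, 'b) ring_scheme \<Rightarrow> 'a set \<Rightarrow> nat" where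
  "min_gens A I = (LEAST k. \<exists>G\<subseteq>carrier A. finite G \<and> card G = k \<and> genideal A G = I)"

definition regular_local_ring :: "('a, 'b) ring_scheme \<Rightarrow> bool" where
  "regular_local_ring A \<longleftrightarrow>
     cring A \<and> noetherian_ring A \<and>
     (\<exists>!M. maximalideal M A) \<and> enat (min_gens A (THE M. maximalideal M A)) = krull_dim A"


section \<open>The hypersurface \<open>V(F)\<close> and its local rings\<close>

definition hypersurface :: "'s::finite cpoly \<Rightarrow> ('s \<Rightarrow> complex) set" where
  "hypersurface F = {p. cpoly_eval p F = 0}"

definition point_ideal :: "('s::finite \<Rightarrow> complex) \<Rightarrow> 's cpoly set" where
  "point_ideal p = {f. cpoly_eval p f = 0}"

definition princ_ideal :: "'s cpoly \<Rightarrow> 's cpoly set" where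
  "princ_ideal F = genideal (class_ring :: 's cpoly ring) {F}"

definition coord_ring :: "'s cpoly \<Rightarrow> 's cpoly set ring" where
  "coord_ring F = (class_ring :: 's cpoly ring) Quot princ_ideal F"

definition residue :: "'s cpoly \<Rightarrow> 's cpoly \<Rightarrow> 's cpoly set" where
  "residue F f = princ_ideal F +>\<^bsub>(class_ring :: 's cpoly ring)\<^esub> f"

text \<open>The maximal ideal of \<open>p\<close> in the coordinate ring, for \<open>p\<close> on the hypersurface, and its
  complement.\<close>

definition coord_ideal :: "'s::finite cpoly \<Rightarrow> ('s \<Rightarrow> complex) \<Rightarrow> 's cpoly set set" where
  "coord_ideal F p = residue F ` point_ideal p"

definition denoms :: "'s::finite cpoly \<Rightarrow> ('s \<Rightarrow> complex) \<Rightarrow> 's cpoly set set" where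
  "denoms F p = carrier (coord_ring F) - coord_ideal F p"

definition local_ring ::
    "'s::finite cpoly \<Rightarrow> ('s \<Rightarrow> complex) \<Rightarrow> ('s cpoly set \<times> 's cpoly set) set ring" where
  "local_ring F p = localization (coord_ring F) (denoms F p)"

definition local_ideal ::
    "'s::finite cpoly \<Rightarrow> ('s \<Rightarrow> complex) \<Rightarrow> ('s cpoly set \<times> 's cpoly set) set set" where
  "local_ideal F p =
     {fraction (coord_ring F) (denoms F p) a s | a s. a \<in> coord_ideal F p \<and> s \<in> denoms F p}"

text \<open>The germ at \<open>p\<close> of the restriction of a polynomial to the hypersurface.\<close>

definition germ ::
    "'s::finite cpoly \<Rightarrow> ('s \<Rightarrow> complex) \<Rightarrow> 's cpoly \<Rightarrow> ('s cpoly set \<times> 's cpoly set) set" where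
  "germ F p f = fraction (coord_ring F) (denoms F p) (residue F f) \<one>\<^bsub>coord_ring F\<^esub>"

text \<open>
  Regularity is that of the local ring of \<open>\<complex>[x] / \<langle>F\<rangle>\<close>, so multiplicities of factors of \<open>F\<close> count.
\<close>

definition nonsingular_point :: "'s::finite cpoly \<Rightarrow> ('s \<Rightarrow> complex) \<Rightarrow> bool" where
  "nonsingular_point F p \<longleftrightarrow> p \<in> hypersurface F \<and> regular_local_ring (local_ring F p)"


section \<open>Tangent spaces of order \<open>n\<close>\<close>

text \<open>
  For an ideal \<open>I\<close> of a ring \<open>A\<close> that is a complex algebra through \<open>\<kappa>\<close>, the complex vector space
  \<open>I / I\<^sup>n\<^sup>+\<^sup>1\<close>, whose vectors are cosets. The fields \<open>mult\<close> and \<open>one\<close> of the module record play no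
  role. In a local ring with residue field \<open>\<complex>\<close> the scalars act through the constants.
\<close>

definition ideal_power :: "('a, 'b) ring_scheme \<Rightarrow> 'a set \<Rightarrow> nat \<Rightarrow> 'a set" where
  "ideal_power A I k = I [^]\<^bsub>ideals_set A\<^esub> k"

definition cotangent ::
    "('a, 'b) ring_scheme \<Rightarrow> (complex \<Rightarrow> 'a) \<Rightarrow> 'a set \<Rightarrow> nat \<Rightarrow> (complex, 'a set) module" where
  "cotangent A \<kappa> I n =
     (let J = ideal_power A I (Suc n); Q = A Quot J in
      \<lparr> carrier = (\<lambda>x. J +>\<^bsub>A\<^esub> x) ` I,
        monoid.mult = monoid.mult Q, monoid.one = monoid.one Q, ring.zero = ring.zero Q, ring.add = ring.add Q,
        smult = (\<lambda>c C. (J +>\<^bsub>A\<^esub> \<kappa> c) \<otimes>\<^bsub>Q\<^esub> C) \<rparr>)"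

definition dual_space :: "(complex, 'a) module \<Rightarrow> ('a \<Rightarrow> complex) set" where
  "dual_space V =
     {\<phi> \<in> extensional (carrier V).
        (\<forall>x\<in>carrier V. \<forall>y\<in>carrier V. \<phi> (x \<oplus>\<^bsub>V\<^esub> y) = \<phi> x + \<phi> y) \<and>
        (\<forall>c. \<forall>x\<in>carrier V. \<phi> (c \<odot>\<^bsub>V\<^esub> x) = c * \<phi> x)}"

definition tangent_hypersurface ::
    "nat \<Rightarrow> 's::finite cpoly \<Rightarrow> ('s \<Rightarrow> complex) \<Rightarrow>
     (('s cpoly set \<times> 's cpoly set) set set \<Rightarrow> complex) set" where
  "tangent_hypersurface n F p =
     dual_space (cotangent (local_ring F p) (\<lambda>c. germ F p (cpoly_const c)) (local_ideal F p) n)"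

definition tangent_affine ::
    "nat \<Rightarrow> ('s::finite \<Rightarrow> complex) \<Rightarrow> ('s cpoly set \<Rightarrow> complex) set" where
  "tangent_affine n p =
     dual_space (cotangent (class_ring :: 's cpoly ring) cpoly_const (point_ideal p) n)"

definition affine_class :: "nat \<Rightarrow> ('s::finite \<Rightarrow> complex) \<Rightarrow> 's cpoly \<Rightarrow> 's cpoly set" where
  "affine_class n p f =
     ideal_power (class_ring :: 's cpoly ring) (point_ideal p) (Suc n)
       +>\<^bsub>(class_ring :: 's cpoly ring)\<^esub> f"

definition local_class ::
    "nat \<Rightarrow> 's::finite cpoly \<Rightarrow> ('s \<Rightarrow> complex) \<Rightarrow> 's cpoly \<Rightarrow>
     ('s cpoly set \<times> 's cpoly set) set set" where
  "local_class n F p f =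
     ideal_power (local_ring F p) (local_ideal F p) (Suc n) +>\<^bsub>local_ring F p\<^esub> germ F p f"

definition taylor :: "nat \<Rightarrow> ('s::{finite,linorder} \<Rightarrow> complex) \<Rightarrow> 's cpoly \<Rightarrow> complex vec" where
  "taylor n p f =
     vec (((n + CARD('s)) choose CARD('s)) - 1)
       (\<lambda>j. let \<alpha> = mindices 1 n ! j in
          cpoly_eval p (cpoly_mderiv \<alpha> f) / of_nat (mi_fact \<alpha>))"

text \<open>
  The tangent space of order \<open>n\<close> of the hypersurface as a subset of \<open>\<complex>\<^sup>N\<^sup>-\<^sup>1\<close>. A vector \<open>t\<close> lies in
  it iff the functional \<open>\<psi>\<close> on the cotangent space of affine space that corresponds to \<open>t\<close> under
  the isomorphism induced by the Taylor coefficients is the restriction, along the map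
  of cotangent spaces induced by \<^term>\<open>germ F p\<close>, of a tangent functional \<open>\<phi>\<close> of the hypersurface.
\<close>

definition tangent_coords ::
    "nat \<Rightarrow> 's::{finite,linorder} cpoly \<Rightarrow> ('s \<Rightarrow> complex) \<Rightarrow> complex vec set" where
  "tangent_coords n F p =
     {t \<in> carrier_vec (((n + CARD('s)) choose CARD('s)) - 1).
        \<exists>\<psi>\<in>tangent_affine n p. \<exists>\<phi>\<in>tangent_hypersurface n F p.
          (\<forall>f\<in>point_ideal p. \<psi> (affine_class n p f) = t \<bullet> taylor n p f) \<and>
          (\<forall>f\<in>point_ideal p. \<psi> (affine_class n p f) = \<phi> (local_class n F p f))}"

end

theory Submission
  imports Defs
begin

text \<open>
  The local ring of a hypersurface \<open>V(F)\<close> at a point \<open>p\<close> is a quotient of the local ring of affine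
  space, and localizing at \<open>p\<close> changes nothing modulo a power of the maximal ideal: a polynomial
  \<open>g\<close> with \<open>g(p) \<noteq> 0\<close> is invertible modulo every power of the ideal \<open>\<aa>\<close> of \<open>p\<close>. Hence
  \<open>\<mm> / \<mm>\<^sup>n\<^sup>+\<^sup>1\<close> is the quotient of \<open>\<aa> / \<aa>\<^sup>n\<^sup>+\<^sup>1\<close> by the image of the ideal \<open>\<langle>F\<rangle>\<close>, and its dual consists of
  the functionals on \<open>\<aa> / \<aa>\<^sup>n\<^sup>+\<^sup>1\<close> that kill all multiples \<open>b F\<close>. In coordinates: \<open>t\<close> is a tangent vector
  iff \<open>t\<close> is orthogonal to the Taylor vector of \<open>b F\<close> for every polynomial \<open>b\<close>.

  By the Leibniz rule for Taylor coefficients, the coefficient of \<open>b F\<close> at \<open>\<alpha>\<close> is the sum over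
  \<open>\<beta> \<le> \<alpha>\<close> of the coefficient of \<open>b\<close> at \<open>\<beta>\<close> times that of \<open>F\<close> at \<open>\<alpha> - \<beta>\<close>. The second
  factors are the entries of row \<open>\<beta>\<close> of the Jacobian matrix, and since \<open>F(p) = 0\<close> only rows with
  \<open>|\<beta>| < n\<close> contribute for \<open>|\<alpha>| \<le> n\<close>. So the Taylor vector of \<open>b F\<close> is a combination of the rows whose
  coefficients are the Taylor coefficients of \<open>b\<close>. These can be prescribed arbitrarily, so the
  multiples of \<open>F\<close> span exactly the row space, and orthogonality to them is membership in the
  kernel (\<open>mat_kernel_Jac_at_iff\<close>).

  For the comparison of the two cotangent spaces, \<open>germ_in_local_ideal_powerD\<close> computes the kernel
  of the map \<open>\<aa> \<rightarrow> \<mm> / \<mm>\<^sup>k\<close>, \<open>local_ideal_approx\<close> gives its surjectivity, and \<open>tangent_functionals\<close>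
  turns a functional on polynomials into functionals on both cotangent spaces.
\<close>

section \<open>Taylor coefficients\<close>

text \<open>
  The coefficient of \<open>(x - p)\<^sup>\<alpha>\<close> in the expansion of \<open>f\<close> at \<open>p\<close>. Defining it by the binomial
  expansion of each monomial makes the Leibniz rule a Vandermonde convolution; the link with
  derivatives is \<open>cpoly_eval_mderiv\<close>. Monomials with an exponent below \<open>\<alpha>\<close> contribute \<open>0\<close> through
  the binomial coefficient, so the truncated subtraction in the exponent is harmless.
\<close>

definition taylor_coeff :: "('s::finite \<Rightarrow> complex) \<Rightarrow> 's mindex \<Rightarrow> 's cpoly \<Rightarrow> complex" where
  "taylor_coeff p \<alpha> f =
     (\<Sum>m\<in>Poly_Mapping.keys f. Poly_Mapping.lookup f m *
        (\<Prod>i\<in>UNIV. of_nat (mi m i choose mi \<alpha> i) * p i ^ (mi m i - mi \<alpha> i)))"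

text \<open>
  A polynomial is the sum of its terms, so additive statements need only be checked on monomials.
\<close>

lemma cpoly_induct [case_names single add]:
  assumes single: "\<And>m c. P (Poly_Mapping.single m c)"
    and add: "\<And>f g. P f \<Longrightarrow> P g \<Longrightarrow> P (f + g)"
  shows "P (f :: 's cpoly)"
proof -
  have "f = (\<Sum>m\<in>Poly_Mapping.keys f. Poly_Mapping.single m (Poly_Mapping.lookup f m))"
    by (rule poly_mapping_eqI)
      (auto simp: lookup_sum lookup_single when_def in_keys_iff)
  moreover have "P (\<Sum>m\<in>A. Poly_Mapping.single m (Poly_Mapping.lookup f m))" if "finite A" for A
    using that
  proof induction
    case empty
    show ?case using single[of 0 0] by simp
  next
    case (insert m A)
    then show ?case by (simp add: add single)
  qed
  ultimately show ?thesis by (metis finite_keys)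
qed

lemma taylor_coeff_superset:
  assumes "finite A" "Poly_Mapping.keys f \<subseteq> A"
  shows "taylor_coeff p \<alpha> f = (\<Sum>m\<in>A. Poly_Mapping.lookup f m *
        (\<Prod>i\<in>UNIV. of_nat (mi m i choose mi \<alpha> i) * p i ^ (mi m i - mi \<alpha> i)))"
  unfolding taylor_coeff_def using assms
  by (intro sum.mono_neutral_left) (auto simp: in_keys_iff)

lemma taylor_coeff_zero [simp]: "taylor_coeff p \<alpha> 0 = 0"
  by (simp add: taylor_coeff_def)

lemma taylor_coeff_add [simp]:
  "taylor_coeff p \<alpha> (f + g) = taylor_coeff p \<alpha> f + taylor_coeff p \<alpha> g"
proof -
  let ?A = "Poly_Mapping.keys f \<union> Poly_Mapping.keys g"
  show ?thesis
    using keys_add[of f g]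
    by (simp add: taylor_coeff_superset[where A = ?A] lookup_add distrib_right sum.distrib)
qed

lemma taylor_coeff_uminus [simp]: "taylor_coeff p \<alpha> (- f) = - taylor_coeff p \<alpha> f"
  using taylor_coeff_add[of p \<alpha> f "- f"] by (simp add: eq_neg_iff_add_eq_0 add.commute)

lemma taylor_coeff_diff [simp]:
  "taylor_coeff p \<alpha> (f - g) = taylor_coeff p \<alpha> f - taylor_coeff p \<alpha> g"
  using taylor_coeff_add[of p \<alpha> f "- g"] by simp

lemma taylor_coeff_single:
  "taylor_coeff p \<alpha> (Poly_Mapping.single m c) =
     c * (\<Prod>i\<in>UNIV. of_nat (mi m i choose mi \<alpha> i) * p i ^ (mi m i - mi \<alpha> i))"
  by (simp add: taylor_coeff_def)

text \<open>
  The multi-indices below \<open>\<alpha>\<close> form a box, so a product over the variables of sums over exponents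
  expands into a sum over multi-indices.
\<close>

lemma mindex_below_bij:
  "bij_betw Poly_Mapping.lookup {\<beta>::'s::finite mindex. mi_le \<beta> \<alpha>} (\<Pi>\<^sub>E i\<in>UNIV. {..mi \<alpha> i})"
proof (rule bij_betwI[where g = Abs_poly_mapping])
  show "Abs_poly_mapping (mi \<beta>) = \<beta>" for \<beta> :: "'s mindex"
    by (rule lookup_inverse)
qed (auto simp: mi_le_def)

lemma finite_mindex_below: "finite {\<beta>::'s::finite mindex. mi_le \<beta> \<alpha>}"
proof -
  have "finite (\<Pi>\<^sub>E i\<in>(UNIV::'s set). {..mi \<alpha> i})"
    by (rule finite_PiE) auto
  then show ?thesis
    using bij_betw_finite[OF mindex_below_bij] by blast
qed

text \<open>
  Vandermonde's identity in the form of the Leibniz rule for the one-variable monomials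
  \<open>x\<^sup>m\<close> and \<open>x\<^sup>k\<close> at the point \<open>z\<close>.
\<close>

lemma vandermonde_weighted:
  fixes z :: complex
  shows "of_nat ((m + k) choose a) * z ^ (m + k - a) =
    (\<Sum>b\<le>a. (of_nat (m choose b) * z ^ (m - b)) * (of_nat (k choose (a - b)) * z ^ (k - (a - b))))"
proof -
  have *: "(of_nat (m choose b) * z ^ (m - b)) * (of_nat (k choose (a - b)) * z ^ (k - (a - b))) =
      of_nat ((m choose b) * (k choose (a - b))) * z ^ (m + k - a)" if "b \<le> a" for b
  \<comment> \<open>Otherwise one of the binomial coefficients vanishes and the exponents do not matter.\<close>
  proof (cases "b \<le> m \<and> a - b \<le> k")
    case True
    then have "m + k - a = (m - b) + (k - (a - b))" using that by auto
    then show ?thesis by (simp add: power_add)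
  next
    case False
    then have "(m choose b) * (k choose (a - b)) = 0" by (auto simp: binomial_eq_0)
    then show ?thesis
      by (metis (no_types, lifting) mult.commute mult.left_commute mult_zero_left of_nat_0 of_nat_mult)
  qed
  have "of_nat ((m + k) choose a) * z ^ (m + k - a) =
      (\<Sum>b\<le>a. of_nat ((m choose b) * (k choose (a - b))) * z ^ (m + k - a))"
    by (simp only: vandermonde[symmetric] of_nat_sum sum_distrib_right)
  also have "\<dots> = (\<Sum>b\<le>a. (of_nat (m choose b) * z ^ (m - b)) *
      (of_nat (k choose (a - b)) * z ^ (k - (a - b))))"
    by (intro sum.cong refl, subst *) auto
  finally show ?thesis .
qed

text \<open>
  The Leibniz rule for divided derivatives. Both sides are bilinear; on monomials the left side is
  a product over the variables of one-variable Leibniz sums.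
\<close>

lemma taylor_coeff_mult:
  fixes f g :: "'s::finite cpoly"
  shows "taylor_coeff p \<alpha> (f * g) =
    (\<Sum>\<beta> | mi_le \<beta> \<alpha>. taylor_coeff p \<beta> f * taylor_coeff p (\<alpha> - \<beta>) g)"
proof (induction f rule: cpoly_induct)
  case (single m c)
  show ?case
  proof (induction g rule: cpoly_induct)
    case (single k d)
    let ?w = "\<lambda>i b. of_nat (mi m i choose b) * p i ^ (mi m i - b) *
      (of_nat (mi k i choose (mi \<alpha> i - b)) * p i ^ (mi k i - (mi \<alpha> i - b)))"
    have "taylor_coeff p \<alpha> (Poly_Mapping.single m c * Poly_Mapping.single k d) =
        c * d * (\<Prod>i\<in>UNIV. \<Sum>b\<le>mi \<alpha> i. ?w i b)"
      by (simp add: mult_single taylor_coeff_single lookup_add vandermonde_weighted)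
    also have "\<dots> = c * d * (\<Sum>h\<in>(\<Pi>\<^sub>E i\<in>UNIV. {..mi \<alpha> i}). \<Prod>i\<in>UNIV. ?w i (h i))"
      by (subst prod_sum_PiE) auto
    also have "\<dots> = c * d * (\<Sum>\<beta> | mi_le \<beta> \<alpha>. \<Prod>i\<in>UNIV. ?w i (mi \<beta> i))"
      by (subst sum.reindex_bij_betw[OF mindex_below_bij, symmetric]) simp
    finally show ?case
      by (simp add: taylor_coeff_single lookup_minus sum_distrib_left prod.distrib mult_ac)
  next
    case (add g h)
    then show ?case by (simp add: distrib_left sum.distrib)
  qed
next
  case (add f h)
  then show ?case by (simp add: distrib_right sum.distrib)
qed

lemma cpoly_eval_eq_taylor_coeff: "cpoly_eval p f = taylor_coeff p 0 f"
  by (simp add: cpoly_eval_def taylor_coeff_def)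

lemma mindex_below_zero [simp]: "{\<beta>. mi_le \<beta> 0} = {0}"
  by (auto simp: mi_le_def intro: poly_mapping_eqI)

lemma cpoly_eval_simps [simp]:
  "cpoly_eval p 0 = 0"
  "cpoly_eval p (f + g) = cpoly_eval p f + cpoly_eval p g"
  "cpoly_eval p (f - g) = cpoly_eval p f - cpoly_eval p g"
  "cpoly_eval p (- f) = - cpoly_eval p f"
  "cpoly_eval p (f * g) = cpoly_eval p f * cpoly_eval p g"
  by (simp_all add: cpoly_eval_eq_taylor_coeff taylor_coeff_mult)

lemma taylor_coeff_const: "taylor_coeff p \<alpha> (cpoly_const c) = (if \<alpha> = 0 then c else 0)"
proof (cases "\<alpha> = 0")
  case False
  then obtain i where i: "mi \<alpha> i \<noteq> 0"
    by (metis lookup_zero poly_mapping_eqI)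
  have "(\<Prod>i\<in>UNIV. of_nat (0 choose mi \<alpha> i) * p i ^ (0 - mi \<alpha> i)) = 0"
    using i by (intro prod_zero) (auto intro!: bexI[of _ i] simp: binomial_eq_0)
  then show ?thesis using False by (simp add: cpoly_const_def taylor_coeff_single)
qed (simp add: cpoly_const_def taylor_coeff_single)

lemma cpoly_eval_const [simp]: "cpoly_eval p (cpoly_const c) = c"
  by (simp add: cpoly_eval_eq_taylor_coeff taylor_coeff_const)

lemma cpoly_const_1: "cpoly_const 1 = 1" by (simp add: cpoly_const_def)
lemma cpoly_eval_1 [simp]: "cpoly_eval p 1 = 1"
  by (metis cpoly_eval_const cpoly_const_1)

lemma taylor_coeff_const_mult [simp]:
  "taylor_coeff p \<alpha> (cpoly_const c * f) = c * taylor_coeff p \<alpha> f"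
  by (induction f rule: cpoly_induct)
    (simp_all add: cpoly_const_def mult_single taylor_coeff_single distrib_left)

section \<open>Divided derivatives and the entries of the Jacobian matrix\<close>

lemma cpoly_pderiv_superset:
  assumes "finite A" "Poly_Mapping.keys f \<subseteq> A"
  shows "cpoly_pderiv i f = (\<Sum>m\<in>A. Poly_Mapping.single (m - Poly_Mapping.single i 1)
          (of_nat (mi m i) * Poly_Mapping.lookup f m))"
  unfolding cpoly_pderiv_def using assms
  by (intro sum.mono_neutral_left) (auto simp: in_keys_iff)

lemma cpoly_pderiv_add: "cpoly_pderiv i (f + g) = cpoly_pderiv i f + cpoly_pderiv i g"
proof -
  let ?A = "Poly_Mapping.keys f \<union> Poly_Mapping.keys g"
  show ?thesis
    using keys_add[of f g]
    by (simp add: cpoly_pderiv_superset[where A = ?A] lookup_add distrib_left single_add sum.distrib)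
qed

lemma cpoly_mderiv_add: "cpoly_mderiv \<alpha> (f + g) = cpoly_mderiv \<alpha> f + cpoly_mderiv \<alpha> g"
proof -
  have pow: "(cpoly_pderiv i ^^ k) (f + g) = (cpoly_pderiv i ^^ k) f + (cpoly_pderiv i ^^ k) g"
    for i k and f g :: "'a cpoly"
    by (induction k) (simp_all add: cpoly_pderiv_add)
  have "foldr (\<lambda>i. cpoly_pderiv i ^^ mi \<alpha> i) xs (f + g) =
      foldr (\<lambda>i. cpoly_pderiv i ^^ mi \<alpha> i) xs f + foldr (\<lambda>i. cpoly_pderiv i ^^ mi \<alpha> i) xs g" for xs
    by (induction xs) (simp_all add: pow)
  then show ?thesis by (simp add: cpoly_mderiv_def)
qed

lemma cpoly_pderiv_single:
  "cpoly_pderiv i (Poly_Mapping.single m c) =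
     Poly_Mapping.single (m - Poly_Mapping.single i 1) (of_nat (mi m i) * c)"
  by (simp add: cpoly_pderiv_def)

lemma cpoly_pderiv_pow_single:
  "(cpoly_pderiv i ^^ k) (Poly_Mapping.single m c) =
     Poly_Mapping.single (m - Poly_Mapping.single i k) (of_nat (fact k * (mi m i choose k)) * c)"
proof (induction k)
  case (Suc k)
  have "m - Poly_Mapping.single i k - Poly_Mapping.single i 1 = m - Poly_Mapping.single i (Suc k)"
    by (rule poly_mapping_eqI) (simp add: lookup_minus lookup_single when_def)
  moreover have "(mi m i - k) * (fact k * (mi m i choose k)) = fact (Suc k) * (mi m i choose Suc k)"
  proof -
    have "(mi m i - k) * (mi m i choose k) = Suc k * (mi m i choose Suc k)"
      by (simp only: binomial_absorb_comp binomial_absorption)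
    then have "fact k * ((mi m i - k) * (mi m i choose k)) = fact k * (Suc k * (mi m i choose Suc k))"
      by (simp only:)
    then show ?thesis by (simp only: fact_Suc of_nat_id mult_ac)
  qed
  ultimately show ?case
    by (simp add: Suc.IH cpoly_pderiv_single lookup_minus del: fact_Suc binomial_Suc_n flip: mult.assoc of_nat_mult)
qed simp

text \<open>
  The iterated derivative is a fold over the variables. Each variable changes only its own exponent,
  so the factor contributed by a variable does not depend on those treated before it.
\<close>

lemma cpoly_mderiv_single:
  "cpoly_mderiv \<alpha> (Poly_Mapping.single m c) =
     Poly_Mapping.single (m - \<alpha>) (of_nat (mi_fact \<alpha>) * (of_nat (mi_choose m \<alpha>) * c))"
proof -
  have *: "foldr (\<lambda>i. cpoly_pderiv i ^^ mi \<alpha> i) xs (Poly_Mapping.single m c) =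
      Poly_Mapping.single (m - (\<Sum>i\<in>set xs. Poly_Mapping.single i (mi \<alpha> i)))
        (of_nat (\<Prod>i\<in>set xs. fact (mi \<alpha> i) * (mi m i choose mi \<alpha> i)) * c)"
    if "distinct xs" for xs
    using that
  proof (induction xs)
    case (Cons a xs)
    \<comment> \<open>The derivatives in the later variables leave the exponent of \<open>a\<close> unchanged.\<close>
    have "mi (m - (\<Sum>i\<in>set xs. Poly_Mapping.single i (mi \<alpha> i))) a = mi m a"
      using Cons.prems by (auto simp: lookup_minus lookup_sum lookup_single when_def)
    then show ?case
      using Cons by (simp add: cpoly_pderiv_pow_single diff_diff_eq add.commute mult_ac)
  qed simp
  \<comment> \<open>The order of the fold does not show in the result, as all variables occur exactly once.\<close>
  have "(\<Sum>i\<in>UNIV. Poly_Mapping.single i (mi \<alpha> i)) = \<alpha>"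
    by (rule poly_mapping_eqI) (simp add: lookup_sum lookup_single when_def)
  then show ?thesis
    using *[of "sorted_list_of_set UNIV"]
    by (simp add: cpoly_mderiv_def mi_fact_def mi_choose_def prod.distrib mult.assoc)
qed

lemma cpoly_eval_mderiv:
  "cpoly_eval p (cpoly_mderiv \<alpha> f) = of_nat (mi_fact \<alpha>) * taylor_coeff p \<alpha> f"
proof (induction f rule: cpoly_induct)
  case (single m c)
  show ?case
    by (simp add: cpoly_mderiv_single cpoly_eval_eq_taylor_coeff taylor_coeff_single
        mi_choose_def lookup_minus prod.distrib of_nat_prod mult_ac)
next
  case (add f g)
  then show ?case by (simp add: cpoly_mderiv_add distrib_left)
qed

lemma mi_fact_nonzero [simp]: "mi_fact \<alpha> \<noteq> 0"
  by (simp add: mi_fact_def)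

lemma mi_choose_fact:
  assumes "mi_le \<beta> \<alpha>"
  shows "mi_fact \<beta> * mi_fact (\<alpha> - \<beta>) * mi_choose \<alpha> \<beta> = mi_fact \<alpha>"
proof -
  have "fact (mi \<beta> i) * fact (mi \<alpha> i - mi \<beta> i) * (mi \<alpha> i choose mi \<beta> i) = fact (mi \<alpha> i)" for i
    using assms binomial_fact_lemma[of "mi \<beta> i" "mi \<alpha> i"] by (simp add: mi_le_def)
  then show ?thesis
    by (simp add: mi_fact_def mi_choose_def lookup_minus flip: prod.distrib)
qed

text \<open>
  The factorials in the definition of the Jacobian matrix are normalized so that its entries are
  Taylor coefficients of \<open>F\<close>, without further factors.
\<close>

lemma cpoly_eval_jac_entry:
  "cpoly_eval p (jac_entry F \<beta> \<alpha>) = (if mi_le \<beta> \<alpha> then taylor_coeff p (\<alpha> - \<beta>) F else 0)"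
proof (cases "mi_le \<beta> \<alpha>")
  case True
  have "(of_nat (mi_fact \<beta>) * of_nat (mi_choose \<alpha> \<beta>)) * of_nat (mi_fact (\<alpha> - \<beta>)) =
      (of_nat (mi_fact \<alpha>) :: complex)"
    using mi_choose_fact[OF True] by (metis mult.assoc mult.commute of_nat_mult)
  then show ?thesis
    using True by (simp add: jac_entry_def cpoly_eval_mderiv divide_simps mult.assoc)
qed (simp add: jac_entry_def)

section \<open>The enumeration of multi-indices\<close>

lemma grlex_linorder:
  "class.linorder (\<lambda>\<alpha> \<beta>. \<alpha> = \<beta> \<or> grlex_less \<alpha> \<beta>) (grlex_less :: 's::{finite,linorder} mindex \<Rightarrow> _)"
proof -
  have irrefl: "\<not> grlex_less \<alpha> \<alpha>" for \<alpha> :: "'s mindex"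
    by (auto simp: grlex_less_def)
  have trans: "grlex_less \<alpha> \<gamma>" if ab: "grlex_less \<alpha> \<beta>" and bc: "grlex_less \<beta> \<gamma>" for \<alpha> \<beta> \<gamma> :: "'s mindex"
  proof (cases "mi_deg \<alpha> < mi_deg \<gamma>")
    case False
    with ab bc have deg: "mi_deg \<alpha> = mi_deg \<gamma>" by (auto simp: grlex_less_def)
    obtain i where i: "mi \<alpha> i < mi \<beta> i" "\<forall>j>i. mi \<alpha> j = mi \<beta> j"
      using ab bc False by (auto simp: grlex_less_def)
    obtain k where k: "mi \<beta> k < mi \<gamma> k" "\<forall>j>k. mi \<beta> j = mi \<gamma> j"
      using ab bc False by (auto simp: grlex_less_def)
    have "mi \<alpha> (max i k) < mi \<gamma> (max i k) \<and> (\<forall>j>max i k. mi \<alpha> j = mi \<gamma> j)"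
      using i k by (cases i k rule: linorder_cases) (auto simp: max_def)
    then show ?thesis using deg by (auto simp: grlex_less_def)
  qed (simp add: grlex_less_def)
  have total: "grlex_less \<alpha> \<beta> \<or> grlex_less \<beta> \<alpha>" if "\<alpha> \<noteq> \<beta>" for \<alpha> \<beta> :: "'s mindex"
  proof (cases "mi_deg \<alpha> = mi_deg \<beta>")
    case True
    \<comment> \<open>The largest variable in which the exponents differ decides.\<close>
    let ?D = "{i. mi \<alpha> i \<noteq> mi \<beta> i}"
    have "?D \<noteq> {}" using that by (auto intro: poly_mapping_eqI)
    then have "Max ?D \<in> ?D" by (intro Max_in) auto
    moreover have "mi \<alpha> j = mi \<beta> j" if "j > Max ?D" for j
      using that Max_ge[of ?D j] by (auto simp: not_le[symmetric])
    ultimately have "(\<exists>i. mi \<alpha> i < mi \<beta> i \<and> (\<forall>j>i. mi \<alpha> j = mi \<beta> j)) \<or>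
        (\<exists>i. mi \<beta> i < mi \<alpha> i \<and> (\<forall>j>i. mi \<beta> j = mi \<alpha> j))"
      by (metis (mono_tags, lifting) linorder_neqE_nat mem_Collect_eq)
    then show ?thesis
      using True by (auto simp: grlex_less_def)
  qed (auto simp: grlex_less_def)
  show ?thesis
  proof unfold_locales
    fix \<alpha> \<beta> \<gamma> :: "'s mindex"
    show "grlex_less \<alpha> \<beta> \<longleftrightarrow> (\<alpha> = \<beta> \<or> grlex_less \<alpha> \<beta>) \<and> \<not> (\<beta> = \<alpha> \<or> grlex_less \<beta> \<alpha>)"
      using irrefl trans[of \<alpha> \<beta> \<alpha>] by auto
    show "\<alpha> = \<gamma> \<or> grlex_less \<alpha> \<gamma>"
      if "\<alpha> = \<beta> \<or> grlex_less \<alpha> \<beta>" "\<beta> = \<gamma> \<or> grlex_less \<beta> \<gamma>"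
      using that trans[of \<alpha> \<beta> \<gamma>] by auto
    show "\<alpha> = \<beta>" if "\<alpha> = \<beta> \<or> grlex_less \<alpha> \<beta>" "\<beta> = \<alpha> \<or> grlex_less \<beta> \<alpha>"
      using that irrefl trans[of \<alpha> \<beta> \<alpha>] by auto
    show "(\<alpha> = \<beta> \<or> grlex_less \<alpha> \<beta>) \<or> (\<beta> = \<alpha> \<or> grlex_less \<beta> \<alpha>)"
      using total[of \<alpha> \<beta>] by auto
  qed simp
qed

text \<open>
  Adding the slack \<open>d - |\<alpha>|\<close> as one more entry turns a multi-index of degree at most \<open>d\<close> into a list
  of length \<open>s + 1\<close> with sum exactly \<open>d\<close>.
\<close>

lemma card_mi_deg_le:
  "card {\<alpha>::'s::finite mindex. mi_deg \<alpha> \<le> d} = (d + CARD('s)) choose CARD('s)"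
proof -
  obtain xs :: "'s list" where xs: "set xs = UNIV" "distinct xs"
    using finite_distinct_list[of "UNIV :: 's set"] by auto
  have len: "length xs = CARD('s)" using xs by (metis distinct_card)
  have deg: "mi_deg \<alpha> = sum_list (map (mi \<alpha>) xs)" for \<alpha> :: "'s mindex"
    using xs by (simp add: mi_deg_def sum_list_distinct_conv_sum_set)
  let ?L = "{l::nat list. length l = Suc (CARD('s)) \<and> sum_list l = d}"
  let ?h = "\<lambda>\<alpha>::'s mindex. (d - mi_deg \<alpha>) # map (mi \<alpha>) xs"
  let ?g = "\<lambda>l. Abs_poly_mapping (\<lambda>i. the (map_of (zip xs (tl l)) i)) :: 's mindex"
  have g: "map (mi (?g l)) xs = tl l" if "length l = Suc (CARD('s))" for l
    using that xs len by (intro nth_equalityI) (simp_all add: map_of_zip_nth)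
  have "bij_betw ?h {\<alpha>. mi_deg \<alpha> \<le> d} ?L"
  proof (rule bij_betw_byWitness[where f' = ?g])
    show "\<forall>\<alpha>\<in>{\<alpha>. mi_deg \<alpha> \<le> d}. ?g (?h \<alpha>) = \<alpha>"
      using xs by (auto intro!: poly_mapping_eqI simp: map_of_zip_map)
    show "\<forall>l\<in>?L. ?h (?g l) = l"
    proof
      fix l assume l: "l \<in> ?L"
      then obtain y ys where "l = y # ys" by (cases l) auto
      then show "?h (?g l) = l" using l g[of l] deg[of "?g l"] by auto
    qed
    show "?h ` {\<alpha>. mi_deg \<alpha> \<le> d} \<subseteq> ?L" by (auto simp: len deg)
    show "?g ` ?L \<subseteq> {\<alpha>. mi_deg \<alpha> \<le> d}"
    proof safe
      fix l :: "nat list" assume l: "length l = Suc (CARD('s))" "d = sum_list l"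
      then show "mi_deg (?g l) \<le> sum_list l" using g[of l] deg[of "?g l"] by (cases l) auto
    qed
  qed
  then have "card {\<alpha>::'s mindex. mi_deg \<alpha> \<le> d} = card ?L" by (rule bij_betw_same_card)
  also have "\<dots> = (d + CARD('s)) choose d" by (simp add: card_length_sum_list)
  finally show ?thesis by (simp add: binomial_symmetric[of d])
qed

lemma finite_mi_deg_le: "finite {\<alpha>::'s::finite mindex. mi_deg \<alpha> \<le> d}"
  by (rule card_ge_0_finite) (simp add: card_mi_deg_le)

text \<open>
  The graded lexicographic order is linear, so the description defining \<^const>\<open>mindices\<close> determines a
  unique list.
\<close>

lemma mindices_enumerates:
  "set (mindices a b) = {\<alpha>::'s::{finite,linorder} mindex. a \<le> mi_deg \<alpha> \<and> mi_deg \<alpha> \<le> b}"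
  "distinct (mindices a b :: 's mindex list)"
proof -
  let ?A = "{\<alpha>::'s mindex. a \<le> mi_deg \<alpha> \<and> mi_deg \<alpha> \<le> b}"
  interpret gr: linorder "\<lambda>\<alpha> \<beta>. \<alpha> = \<beta> \<or> grlex_less \<alpha> \<beta>" "grlex_less :: 's mindex \<Rightarrow> _"
    by (rule grlex_linorder)
  have "finite ?A" using finite_mi_deg_le[of b] by (rule rev_finite_subset) auto
  then have "\<exists>!as. sorted_wrt grlex_less as \<and> set as = ?A"
    by (metis (no_types, lifting) gr.strict_sorted_equal gr.finite_set_strict_sorted)
  then have *: "sorted_wrt grlex_less (mindices a b :: 's mindex list) \<and> set (mindices a b) = ?A"
    unfolding mindices_def by (rule theI')
  then show "set (mindices a b) = ?A" by blast
  show "distinct (mindices a b :: 's mindex list)"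
    using * gr.strict_sorted_iff by blast
qed

lemma mi_deg_zero [simp]: "mi_deg 0 = 0"
  by (simp add: mi_deg_def)

lemma mi_deg_eq_0_iff: "mi_deg \<alpha> = 0 \<longleftrightarrow> \<alpha> = 0"
  by (auto simp: mi_deg_def intro: poly_mapping_eqI)

lemma length_mindices_0:
  "length (mindices 0 b :: 's::{finite,linorder} mindex list) = (b + CARD('s)) choose CARD('s)"
  using distinct_card[OF mindices_enumerates(2)[where 's = 's, of 0 b]]
  by (simp add: mindices_enumerates card_mi_deg_le)

text \<open>
  The multi-index \<open>0\<close> is the only one of degree \<open>0\<close>, whence the dimension \<open>N - 1\<close>.
\<close>

lemma length_mindices_1:
  "length (mindices 1 b :: 's::{finite,linorder} mindex list) = ((b + CARD('s)) choose CARD('s)) - 1"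
proof -
  have "{\<alpha>::'s mindex. 1 \<le> mi_deg \<alpha> \<and> mi_deg \<alpha> \<le> b} = {\<alpha>. mi_deg \<alpha> \<le> b} - {0}"
    by (auto simp: Suc_le_eq mi_deg_eq_0_iff simp flip: neq0_conv)
  then have "card {\<alpha>::'s mindex. 1 \<le> mi_deg \<alpha> \<and> mi_deg \<alpha> \<le> b} = ((b + CARD('s)) choose CARD('s)) - 1"
    by (simp add: card_Diff_singleton card_mi_deg_le mi_deg_zero)
  then show ?thesis
    using distinct_card[OF mindices_enumerates(2)[where 's = 's, of 1 b]] by (simp add: mindices_enumerates)
qed

section \<open>Order of vanishing at a point\<close>

lemma mi_deg_mono: "mi_le \<beta> \<alpha> \<Longrightarrow> mi_deg \<beta> \<le> mi_deg \<alpha>"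
  by (simp add: mi_le_def mi_deg_def sum_mono)

lemma mi_deg_diff: "mi_le \<beta> \<alpha> \<Longrightarrow> mi_deg (\<alpha> - \<beta>) = mi_deg \<alpha> - mi_deg \<beta>"
  by (simp add: mi_le_def mi_deg_def lookup_minus sum_subtractf_nat)

lemma mi_diff_add_cancel: "mi_le \<beta> \<alpha> \<Longrightarrow> \<alpha> - \<beta> + \<beta> = \<alpha>"
  by (rule poly_mapping_eqI) (simp add: mi_le_def lookup_add lookup_minus)

text \<open>
  The \<open>k\<close>-th power of the ideal of \<open>p\<close>, described by the vanishing of Taylor coefficients, which makes
  membership accessible to the Leibniz rule.
\<close>

definition order_ideal :: "('s::finite \<Rightarrow> complex) \<Rightarrow> nat \<Rightarrow> 's cpoly set" where
  "order_ideal p k = {f. \<forall>\<alpha>. mi_deg \<alpha> < k \<longrightarrow> taylor_coeff p \<alpha> f = 0}"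

lemma order_ideal_0 [simp]: "order_ideal p 0 = UNIV"
  by (simp add: order_ideal_def)

lemma order_ideal_1: "order_ideal p 1 = point_ideal p"
  by (auto simp: order_ideal_def point_ideal_def cpoly_eval_eq_taylor_coeff mi_deg_eq_0_iff)

text \<open>
  If \<open>|\<alpha>| < k + l\<close> and \<open>\<beta> \<le> \<alpha>\<close>, then \<open>|\<beta>| < k\<close> or \<open>|\<alpha> - \<beta>| < l\<close>; so every term of the Leibniz sum vanishes.
\<close>

lemma order_ideal_mult:
  assumes "f \<in> order_ideal p k" "g \<in> order_ideal p l"
  shows "f * g \<in> order_ideal p (k + l)"
proof -
  have "taylor_coeff p \<beta> f * taylor_coeff p (\<alpha> - \<beta>) g = 0"
    if "mi_deg \<alpha> < k + l" "mi_le \<beta> \<alpha>" for \<alpha> \<beta>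
  proof (cases "mi_deg \<beta> < k")
    case False
    then have "mi_deg (\<alpha> - \<beta>) < l"
      using that mi_deg_mono[OF that(2)] by (simp add: mi_deg_diff)
    then show ?thesis using assms by (simp add: order_ideal_def)
  qed (use assms in \<open>simp add: order_ideal_def\<close>)
  then show ?thesis by (auto simp: order_ideal_def taylor_coeff_mult intro: sum.neutral)
qed

lemma order_ideal_add:
  "f \<in> order_ideal p k \<Longrightarrow> g \<in> order_ideal p k \<Longrightarrow> f + g \<in> order_ideal p k"
  by (simp add: order_ideal_def)

text \<open>
  The expansion at \<open>p\<close> of \<open>x\<^sub>i - p\<^sub>i\<close> has a single term.
\<close>

lemma taylor_coeff_shifted_variable:
  "taylor_coeff p \<delta> (Poly_Mapping.single (Poly_Mapping.single i 1) 1 - cpoly_const (p i)) =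
     (if \<delta> = Poly_Mapping.single i 1 then 1 else 0)"
proof -
  let ?e = "Poly_Mapping.single i 1 :: 'a mindex"
  let ?w = "\<lambda>j. of_nat (mi ?e j choose mi \<delta> j) * p j ^ (mi ?e j - mi \<delta> j)"
  consider "\<delta> = 0" | "\<delta> = ?e" | "\<delta> \<noteq> 0" "\<delta> \<noteq> ?e" by blast
  then show ?thesis
  proof cases
    case 1
    have "(\<Prod>j\<in>UNIV. ?w j) = (\<Prod>j\<in>UNIV. if j = i then p i else 1)"
      by (intro prod.cong) (auto simp: 1 lookup_single)
    moreover have "?e \<noteq> 0" by (metis lookup_single_eq lookup_zero one_neq_zero)
    ultimately show ?thesis
      using 1 by (simp add: taylor_coeff_single taylor_coeff_const)
  next
    case 2
    have "?e \<noteq> 0" by (metis lookup_single_eq lookup_zero one_neq_zero)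
    then show ?thesis
      using 2 by (simp add: taylor_coeff_single taylor_coeff_const)
  next
    case 3
    have "\<exists>j. mi ?e j < mi \<delta> j"
    proof (rule ccontr)
      assume "\<nexists>j. mi ?e j < mi \<delta> j"
      then have le: "mi \<delta> j \<le> mi ?e j" for j by (simp add: not_less)
      then have off: "mi \<delta> j = 0" if "j \<noteq> i" for j
        using le[of j] that by (simp add: lookup_single)
      have "mi \<delta> i \<le> 1" using le[of i] by simp
      then consider "mi \<delta> i = 0" | "mi \<delta> i = 1" by linarith
      then show False
      proof cases
        case 1
        then have "\<delta> = 0" using off by (metis lookup_zero poly_mapping_eqI)
        then show False using 3 by simp
      next
        case 2
        then have "\<delta> = ?e" using off
          by (intro poly_mapping_eqI) (metis lookup_single_eq lookup_single_not_eq)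
        then show False using 3 by simp
      qed
    qed
    then obtain j where "mi ?e j < mi \<delta> j" ..
    then have "(\<Prod>j\<in>UNIV. ?w j) = 0"
      by (intro prod_zero) (auto intro!: bexI[of _ j] simp: binomial_eq_0)
    then show ?thesis
      using 3 by (simp add: taylor_coeff_single taylor_coeff_const)
  qed
qed

text \<open>
  The polynomial is \<open>(x - p)\<^sup>\<beta>\<close>, built up one linear factor at a time. It isolates a single row of the
  Jacobian matrix among the multiples of \<open>F\<close>.
\<close>

lemma taylor_dual_basis:
  obtains e where "\<And>\<gamma>. taylor_coeff p \<gamma> e = (if \<gamma> = \<beta> then 1 else 0)"
proof -
  have "\<exists>e. \<forall>\<gamma>. taylor_coeff p \<gamma> e = (if \<gamma> = \<beta> then 1 else 0)"
  proof (induction "mi_deg \<beta>" arbitrary: \<beta>)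
    case 0
    then have "\<beta> = 0" by (simp add: mi_deg_eq_0_iff)
    then show ?case by (intro exI[of _ "cpoly_const 1"]) (simp add: taylor_coeff_const)
  next
    case (Suc d)
    then obtain i where i: "mi \<beta> i \<noteq> 0"
      by (metis mi_deg_zero lookup_zero nat.distinct(1) poly_mapping_eqI)
    let ?e = "Poly_Mapping.single i 1 :: 'a mindex"
    have le: "mi_le ?e \<beta>" using i by (auto simp: mi_le_def lookup_single when_def)
    have "mi_deg ?e = 1"
      by (simp add: mi_deg_def lookup_single when_def)
    then have "mi_deg (\<beta> - ?e) = d" using Suc(2) mi_deg_diff[OF le] by simp
    then obtain e where e: "\<And>\<gamma>. taylor_coeff p \<gamma> e = (if \<gamma> = \<beta> - ?e then 1 else 0)"
      using Suc(1)[of "\<beta> - ?e"] by auto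
    \<comment> \<open>Truncated subtraction of \<open>?e\<close> is injective only where \<open>?e\<close> fits below.\<close>
    have iff: "\<gamma> - ?e = \<beta> - ?e \<longleftrightarrow> \<gamma> = \<beta>" if "mi_le ?e \<gamma>" for \<gamma>
      using that le by (metis (no_types, lifting) mi_diff_add_cancel)
    have "taylor_coeff p \<gamma> ((Poly_Mapping.single ?e 1 - cpoly_const (p i)) * e) =
        (if \<gamma> = \<beta> then 1 else 0)" for \<gamma>
    proof -
      have "taylor_coeff p \<gamma> ((Poly_Mapping.single ?e 1 - cpoly_const (p i)) * e) =
          (\<Sum>\<delta> | mi_le \<delta> \<gamma>. if \<delta> = ?e then taylor_coeff p (\<gamma> - ?e) e else 0)"
        unfolding taylor_coeff_mult
        by (intro sum.cong) (auto simp: taylor_coeff_shifted_variable simp del: taylor_coeff_diff One_nat_def)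
      also have "\<dots> = (if mi_le ?e \<gamma> then taylor_coeff p (\<gamma> - ?e) e else 0)"
        by (simp add: finite_mindex_below)
      finally show ?thesis using le iff by (auto simp: e simp del: One_nat_def)
    qed
    then show ?case by blast
  qed
  then show ?thesis using that by blast
qed

text \<open>
  The term \<open>\<beta> = \<alpha>\<close> of the Leibniz sum carries the factor \<open>F(p) = 0\<close>, so for \<open>|\<alpha>| \<le> d + 1\<close> only
  multi-indices \<open>\<beta>\<close> of degree at most \<open>d\<close> remain. This is where the size of the Jacobian matrix comes
  from.
\<close>

lemma taylor_coeff_mult_vanishing:
  assumes "cpoly_eval p F = 0" and "mi_deg \<alpha> \<le> Suc d"
  shows "taylor_coeff p \<alpha> (b * F) =
    (\<Sum>\<beta> | mi_deg \<beta> \<le> d. taylor_coeff p \<beta> b * (if mi_le \<beta> \<alpha> then taylor_coeff p (\<alpha> - \<beta>) F else 0))"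
proof -
  let ?S = "{\<beta>. mi_le \<beta> \<alpha> \<and> mi_deg \<beta> \<le> d}"
  have zero: "taylor_coeff p (\<alpha> - \<beta>) F = 0" if "mi_le \<beta> \<alpha>" "\<not> mi_deg \<beta> \<le> d" for \<beta>
  proof -
    have "mi_deg (\<alpha> - \<beta>) = 0" using that assms(2) by (simp add: mi_deg_diff)
    then show ?thesis using assms(1) by (simp add: mi_deg_eq_0_iff cpoly_eval_eq_taylor_coeff)
  qed
  have "taylor_coeff p \<alpha> (b * F) = (\<Sum>\<beta>\<in>?S. taylor_coeff p \<beta> b * taylor_coeff p (\<alpha> - \<beta>) F)"
    unfolding taylor_coeff_mult
    by (rule sum.mono_neutral_right) (auto simp: finite_mindex_below zero)
  also have "\<dots> = (\<Sum>\<beta> | mi_deg \<beta> \<le> d. taylor_coeff p \<beta> b *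
      (if mi_le \<beta> \<alpha> then taylor_coeff p (\<alpha> - \<beta>) F else 0))"
    by (rule sum.mono_neutral_cong_left) (auto simp: finite_mi_deg_le)
  finally show ?thesis .
qed

lemma order_ideal_times: "f \<in> order_ideal p k \<Longrightarrow> h * f \<in> order_ideal p k"
  using order_ideal_mult[of h p 0 f k] by simp

text \<open>
  A polynomial that does not vanish at \<open>p\<close> is, up to a constant, \<open>1 - u\<close> with \<open>u(p) = 0\<close>, and a
  truncated geometric series inverts \<open>1 - u\<close> up to \<open>u\<^sup>k\<close>.
\<close>

lemma inverse_modulo_order_ideal:
  assumes "cpoly_eval p g \<noteq> 0"
  obtains h u where "u \<in> point_ideal p" "g * h = 1 - u ^ k"
proof
  \<comment> \<open>Scaling \<open>g\<close> to the value \<open>1\<close> at \<open>p\<close> makes the difference from \<open>1\<close> vanish there.\<close>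
  let ?u = "1 - g * cpoly_const (1 / cpoly_eval p g)"
  show "?u \<in> point_ideal p" using assms by (simp add: point_ideal_def)
  show "g * (cpoly_const (1 / cpoly_eval p g) * (\<Sum>i<k. ?u ^ i)) = 1 - ?u ^ k"
    by (simp add: one_diff_power_eq mult.assoc)
qed

lemma point_ideal_power: "u \<in> point_ideal p \<Longrightarrow> u ^ k \<in> order_ideal p k"
proof (induction k)
  case (Suc k)
  then show ?case
    using order_ideal_mult[of u p 1 "u ^ k" k] order_ideal_1[of p] by simp
qed simp

section \<open>The kernel of the Jacobian matrix\<close>

lemma scalar_prod_taylor:
  fixes p :: "'s::{finite,linorder} \<Rightarrow> complex"
  shows "t \<bullet> taylor n p f = (\<Sum>j<((n + CARD('s)) choose CARD('s)) - 1.
      t $ j * taylor_coeff p (mindices 1 n ! j) f)"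
  by (simp add: scalar_prod_def taylor_def Let_def cpoly_eval_mderiv atLeast0LessThan)

lemma mindices_1_nth_deg:
  assumes "j < ((n + CARD('s)) choose CARD('s)) - 1"
  shows "mi_deg (mindices 1 n ! j :: 's::{finite,linorder} mindex) \<le> n"
  using assms nth_mem[of j "mindices 1 n :: 's mindex list"]
  by (simp add: length_mindices_1 mindices_enumerates del: nth_mem One_nat_def)

lemma scalar_prod_taylor_simps:
  "t \<bullet> taylor n p 0 = 0"
  "t \<bullet> taylor n p (f + g) = t \<bullet> taylor n p f + t \<bullet> taylor n p g"
  "t \<bullet> taylor n p (f - g) = t \<bullet> taylor n p f - t \<bullet> taylor n p g"
  "t \<bullet> taylor n p (cpoly_const c * f) = c * (t \<bullet> taylor n p f)"
  by (simp_all add: scalar_prod_taylor distrib_left right_diff_distrib sum.distrib sum_subtractf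
      sum_distrib_left mult.left_commute)

lemma scalar_prod_taylor_order_ideal:
  assumes "f \<in> order_ideal p (Suc n)"
  shows "t \<bullet> taylor n p f = 0"
  unfolding scalar_prod_taylor
  by (intro sum.neutral) (use assms mindices_1_nth_deg in \<open>auto simp: order_ideal_def less_Suc_eq_le\<close>)

lemma mat_kernel_Jac_at:
  fixes F :: "'s::{finite,linorder} cpoly"
  assumes "n \<ge> 1"
  shows "mat_kernel (Jac_at n F p) =
    {t \<in> carrier_vec (((n + CARD('s)) choose CARD('s)) - 1).
      \<forall>\<beta>. mi_deg \<beta> \<le> n - 1 \<longrightarrow> (\<Sum>j<((n + CARD('s)) choose CARD('s)) - 1.
        t $ j * cpoly_eval p (jac_entry F \<beta> (mindices 1 n ! j))) = 0}"
proof -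
  let ?M = "(n + CARD('s) - 1) choose CARD('s)" and ?K = "((n + CARD('s)) choose CARD('s)) - 1"
  let ?r = "\<lambda>t \<beta>. \<Sum>j<?K. t $ j * cpoly_eval p (jac_entry F \<beta> (mindices 1 n ! j))"
  have dim: "Jac_at n F p \<in> carrier_mat ?M ?K" by (simp add: Jac_at_def Jac_def)
  have len: "length (mindices 0 (n - 1) :: 's mindex list) = ?M"
    using assms by (simp add: length_mindices_0)
  have "Jac_at n F p *\<^sub>v t = 0\<^sub>v ?M \<longleftrightarrow> (\<forall>\<beta>. mi_deg \<beta> \<le> n - 1 \<longrightarrow> ?r t \<beta> = 0)"
    if "t \<in> carrier_vec ?K" for t
  proof -
    have row: "(Jac_at n F p *\<^sub>v t) $ i = ?r t (mindices 0 (n - 1) ! i)" if "i < ?M" for i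
      using that \<open>t \<in> carrier_vec ?K\<close> carrier_matD[OF dim]
      by (simp add: scalar_prod_def Jac_at_def Jac_def atLeast0LessThan mult.commute)
    have "Jac_at n F p *\<^sub>v t = 0\<^sub>v ?M \<longleftrightarrow> (\<forall>i<?M. ?r t (mindices 0 (n - 1) ! i) = 0)"
      using row carrier_matD[OF dim] by (auto simp: vec_eq_iff)
    also have "\<dots> \<longleftrightarrow> (\<forall>\<beta>\<in>set (mindices 0 (n - 1)). ?r t \<beta> = 0)"
      unfolding all_set_conv_all_nth len ..
    finally show ?thesis by (simp add: mindices_enumerates)
  qed
  then show ?thesis by (auto simp: mat_kernel[OF dim])
qed

text \<open>
  The Taylor vector of \<open>b F\<close> is the combination of the rows of the Jacobian matrix with the Taylor
  coefficients of \<open>b\<close> as weights, and these weights are arbitrary by the dual basis.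
\<close>

proposition mat_kernel_Jac_at_iff:
  fixes F :: "'s::{finite,linorder} cpoly"
  assumes "n \<ge> 1" and F: "cpoly_eval p F = 0"
  shows "t \<in> mat_kernel (Jac_at n F p) \<longleftrightarrow>
    t \<in> carrier_vec (((n + CARD('s)) choose CARD('s)) - 1) \<and> (\<forall>b. t \<bullet> taylor n p (b * F) = 0)"
proof -
  let ?K = "((n + CARD('s)) choose CARD('s)) - 1"
  let ?r = "\<lambda>\<beta>. \<Sum>j<?K. t $ j * cpoly_eval p (jac_entry F \<beta> (mindices 1 n ! j))"
  have expand: "t \<bullet> taylor n p (b * F) = (\<Sum>\<beta> | mi_deg \<beta> \<le> n - 1. taylor_coeff p \<beta> b * ?r \<beta>)" for b
  proof -
    have "t \<bullet> taylor n p (b * F) = (\<Sum>j<?K. \<Sum>\<beta> | mi_deg \<beta> \<le> n - 1.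
        taylor_coeff p \<beta> b * (t $ j * cpoly_eval p (jac_entry F \<beta> (mindices 1 n ! j))))"
      unfolding scalar_prod_taylor
    proof (intro sum.cong refl)
      fix j assume "j \<in> {..<?K}"
      then have "mi_deg (mindices 1 n ! j :: 's mindex) \<le> Suc (n - 1)"
        using mindices_1_nth_deg[of j n] assms(1) by simp
      then show "t $ j * taylor_coeff p (mindices 1 n ! j) (b * F) = (\<Sum>\<beta> | mi_deg \<beta> \<le> n - 1.
          taylor_coeff p \<beta> b * (t $ j * cpoly_eval p (jac_entry F \<beta> (mindices 1 n ! j))))"
        by (simp only: taylor_coeff_mult_vanishing[OF F] cpoly_eval_jac_entry sum_distrib_left
            mult.left_commute)
    qed
    then show ?thesis by (subst (asm) sum.swap) (simp add: sum_distrib_left)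
  qed
  have "(\<forall>b. t \<bullet> taylor n p (b * F) = 0) \<longleftrightarrow> (\<forall>\<beta>. mi_deg \<beta> \<le> n - 1 \<longrightarrow> ?r \<beta> = 0)"
  proof (intro iffI allI impI)
    fix \<beta> :: "'s mindex"
    assume *: "\<forall>b. t \<bullet> taylor n p (b * F) = 0" and "mi_deg \<beta> \<le> n - 1"
    obtain e where "\<And>\<gamma>. taylor_coeff p \<gamma> e = (if \<gamma> = \<beta> then 1 else 0)"
      using taylor_dual_basis by blast
    with * \<open>mi_deg \<beta> \<le> n - 1\<close> show "?r \<beta> = 0"
      \<comment> \<open>The dual polynomial \<open>e\<close> selects row \<open>\<beta>\<close> from the expansion.\<close>
      using expand[of e] by (simp add: if_distrib[of "\<lambda>c. c * _"] finite_mi_deg_le cong: if_cong)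
  qed (simp add: expand)
  then show ?thesis by (simp add: mat_kernel_Jac_at[OF assms(1)])
qed

section \<open>Localization of commutative rings\<close>

text \<open>
  The fractions may be taken over a ring with zero divisors: equality of fractions is equality of
  cross products up to a factor in \<open>S\<close>.
\<close>

locale multiplicative_subset = cring R for R (structure) +
  fixes S :: "'a set"
  assumes S_subset: "S \<subseteq> carrier R"
    and S_one: "\<one> \<in> S"
    and S_mult: "s \<in> S \<Longrightarrow> t \<in> S \<Longrightarrow> s \<otimes> t \<in> S"
begin

lemma S_carrier: "s \<in> S \<Longrightarrow> s \<in> carrier R"
  using S_subset by blast

lemma frac_relI:
  assumes "a \<in> carrier R" "b \<in> carrier R" "s \<in> S" "t \<in> S" "u \<in> S"
    and "u \<otimes> (t \<otimes> a \<ominus> s \<otimes> b) = \<zero>"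
  shows "((a, s), (b, t)) \<in> frac_rel R S"
  using assms by (auto simp: frac_rel_def)

lemma frac_relE:
  assumes "((a, s), (b, t)) \<in> frac_rel R S"
  obtains u where "a \<in> carrier R" "b \<in> carrier R" "s \<in> S" "t \<in> S" "u \<in> S"
    "u \<otimes> (t \<otimes> a \<ominus> s \<otimes> b) = \<zero>"
  using assms by (auto simp: frac_rel_def)

lemma frac_rel_equiv: "equiv (carrier R \<times> S) (frac_rel R S)"
proof (rule equivI)
  show "frac_rel R S \<subseteq> (carrier R \<times> S) \<times> (carrier R \<times> S)"
    by (auto simp: frac_rel_def)
  show "refl_on (carrier R \<times> S) (frac_rel R S)"
  proof (rule refl_onI)
    fix x assume "x \<in> carrier R \<times> S"
    then obtain a s where x: "x = (a, s)" "a \<in> carrier R" "s \<in> S" by auto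
    have "\<one> \<otimes> (s \<otimes> a \<ominus> s \<otimes> a) = \<zero>" using x S_carrier by algebra
    then show "(x, x) \<in> frac_rel R S" using x S_one by (auto intro: frac_relI)
  qed
  show "sym (frac_rel R S)"
  proof (rule symI)
    fix x y assume "(x, y) \<in> frac_rel R S"
    moreover obtain a s b t where xy: "x = (a, s)" "y = (b, t)" by (cases x, cases y)
    ultimately obtain u where u: "a \<in> carrier R" "b \<in> carrier R" "s \<in> S" "t \<in> S" "u \<in> S"
        "u \<otimes> (t \<otimes> a \<ominus> s \<otimes> b) = \<zero>"
      by (auto elim: frac_relE)
    have "u \<otimes> (s \<otimes> b \<ominus> t \<otimes> a) = \<ominus> (u \<otimes> (t \<otimes> a \<ominus> s \<otimes> b))"
      using u(1,2) u(3-5)[THEN S_carrier] by algebra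
    then show "(y, x) \<in> frac_rel R S" using u xy by (auto intro: frac_relI)
  qed
  show "trans (frac_rel R S)"
  proof (rule transI)
    fix x y z assume "(x, y) \<in> frac_rel R S" "(y, z) \<in> frac_rel R S"
    moreover obtain a s b t c r where xyz: "x = (a, s)" "y = (b, t)" "z = (c, r)"
      by (cases x, cases y, cases z)
    ultimately obtain u v where u: "a \<in> carrier R" "b \<in> carrier R" "s \<in> S" "t \<in> S" "u \<in> S"
        "u \<otimes> (t \<otimes> a \<ominus> s \<otimes> b) = \<zero>" and v: "c \<in> carrier R" "r \<in> S" "v \<in> S"
        "v \<otimes> (r \<otimes> b \<ominus> t \<otimes> c) = \<zero>"
      by (auto elim!: frac_relE)
    note car = u(1,2) v(1) u(3-5)[THEN S_carrier] v(2,3)[THEN S_carrier]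
    \<comment> \<open>The middle denominator \<open>t\<close> must enter the annihilating factor, since it need not be regular.\<close>
    have "(u \<otimes> v \<otimes> t) \<otimes> (r \<otimes> a \<ominus> s \<otimes> c) =
        v \<otimes> r \<otimes> (u \<otimes> (t \<otimes> a \<ominus> s \<otimes> b)) \<oplus> u \<otimes> s \<otimes> (v \<otimes> (r \<otimes> b \<ominus> t \<otimes> c))"
      using car by algebra
    also have "\<dots> = \<zero>" using car by (simp add: u v)
    finally show "(x, z) \<in> frac_rel R S"
      using u v xyz by (auto intro!: frac_relI[where u = "u \<otimes> v \<otimes> t"] S_mult)
  qed
qed


lemma fraction_eq_iff:
  assumes "a \<in> carrier R" "b \<in> carrier R" "s \<in> S" "t \<in> S"
  shows "fraction R S a s = fraction R S b t \<longleftrightarrow> (\<exists>u\<in>S. u \<otimes> (t \<otimes> a \<ominus> s \<otimes> b) = \<zero>)"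
  using assms eq_equiv_class_iff[OF frac_rel_equiv, of "(a, s)" "(b, t)"]
  by (auto simp: fraction_def frac_rel_def)

lemma fraction_eqI:
  assumes "a \<in> carrier R" "b \<in> carrier R" "s \<in> S" "t \<in> S" and "t \<otimes> a = s \<otimes> b"
  shows "fraction R S a s = fraction R S b t"
proof -
  have "\<one> \<otimes> (t \<otimes> a \<ominus> s \<otimes> b) = \<zero>"
    unfolding assms(5) using assms(1-4) S_carrier by algebra
  then show ?thesis using assms S_one by (auto simp: fraction_eq_iff)
qed

lemma localization_carrier:
  "carrier (localization R S) = {fraction R S a s | a s. a \<in> carrier R \<and> s \<in> S}"
  by (auto simp: localization_def fraction_def quotient_def)

lemma fraction_closed:
  "a \<in> carrier R \<Longrightarrow> s \<in> S \<Longrightarrow> fraction R S a s \<in> carrier (localization R S)"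
  by (auto simp: localization_carrier)

lemma in_fractionE:
  assumes "(a', s') \<in> fraction R S a s"
  obtains "a' \<in> carrier R" "s' \<in> S" "fraction R S a s = fraction R S a' s'"
proof -
  have "((a, s), (a', s')) \<in> frac_rel R S" using assms by (simp add: fraction_def)
  moreover from this have "fraction R S a s = fraction R S a' s'"
    using equiv_class_eq[OF frac_rel_equiv] by (simp add: fraction_def)
  ultimately show ?thesis using that by (auto elim: frac_relE)
qed

lemma fraction_self: "a \<in> carrier R \<Longrightarrow> s \<in> S \<Longrightarrow> (a, s) \<in> fraction R S a s"
  using equiv_class_self[OF frac_rel_equiv] by (simp add: fraction_def)

text \<open>
  The operations of the localization are unions over all representatives; they collapse to the value
  on any one pair of representatives once that value is independent of the choice.
\<close>

lemma UN_fraction: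
  assumes "a \<in> carrier R" "b \<in> carrier R" "s \<in> S" "t \<in> S"
    and "\<And>a' b' s' t'. a' \<in> carrier R \<Longrightarrow> b' \<in> carrier R \<Longrightarrow> s' \<in> S \<Longrightarrow> t' \<in> S \<Longrightarrow>
      fraction R S a s = fraction R S a' s' \<Longrightarrow> fraction R S b t = fraction R S b' t' \<Longrightarrow>
      h a' s' b' t' = h a s b t"
  shows "(\<Union>(a', s')\<in>fraction R S a s. \<Union>(b', t')\<in>fraction R S b t. h a' s' b' t') = h a s b t"
proof -
  have "h a' s' b' t' = h a s b t"
    if "(a', s') \<in> fraction R S a s" "(b', t') \<in> fraction R S b t" for a' s' b' t'
    using that assms(5) by (metis in_fractionE)
  then show ?thesis using fraction_self[OF assms(1,3)] fraction_self[OF assms(2,4)] by fast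
qed

lemma fraction_mult:
  assumes "a \<in> carrier R" "b \<in> carrier R" "s \<in> S" "t \<in> S"
  shows "fraction R S a s \<otimes>\<^bsub>localization R S\<^esub> fraction R S b t = fraction R S (a \<otimes> b) (s \<otimes> t)"
proof -
  have "fraction R S (a' \<otimes> b') (s' \<otimes> t') = fraction R S (a \<otimes> b) (s \<otimes> t)"
    if c: "a' \<in> carrier R" "b' \<in> carrier R" "s' \<in> S" "t' \<in> S"
      and eq: "fraction R S a s = fraction R S a' s'" "fraction R S b t = fraction R S b' t'"
    for a' b' s' t'
  proof -
    obtain u v where uv: "u \<in> S" "v \<in> S" "u \<otimes> (s' \<otimes> a \<ominus> s \<otimes> a') = \<zero>" "v \<otimes> (t' \<otimes> b \<ominus> t \<otimes> b') = \<zero>"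
      using eq assms c by (auto simp: fraction_eq_iff)
    note car = assms(1,2) c(1,2) assms(3,4)[THEN S_carrier] c(3,4)[THEN S_carrier] uv(1,2)[THEN S_carrier]
    have "(u \<otimes> v) \<otimes> ((s' \<otimes> t') \<otimes> (a \<otimes> b) \<ominus> (s \<otimes> t) \<otimes> (a' \<otimes> b')) =
        v \<otimes> t' \<otimes> b \<otimes> (u \<otimes> (s' \<otimes> a \<ominus> s \<otimes> a')) \<oplus> u \<otimes> s \<otimes> a' \<otimes> (v \<otimes> (t' \<otimes> b \<ominus> t \<otimes> b'))"
      using car by algebra
    also have "\<dots> = \<zero>" using car by (simp add: uv)
    finally have "fraction R S (a \<otimes> b) (s \<otimes> t) = fraction R S (a' \<otimes> b') (s' \<otimes> t')"
      using assms c uv by (auto simp: fraction_eq_iff S_mult intro!: bexI[of _ "u \<otimes> v"])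
    then show ?thesis ..
  qed
  then have "(\<Union>(a', s')\<in>fraction R S a s. \<Union>(b', t')\<in>fraction R S b t.
      fraction R S (a' \<otimes> b') (s' \<otimes> t')) = fraction R S (a \<otimes> b) (s \<otimes> t)"
    by (rule UN_fraction[OF assms])
  then show ?thesis by (simp only: localization_def monoid.simps)
qed

lemma fraction_add:
  assumes "a \<in> carrier R" "b \<in> carrier R" "s \<in> S" "t \<in> S"
  shows "fraction R S a s \<oplus>\<^bsub>localization R S\<^esub> fraction R S b t = fraction R S (t \<otimes> a \<oplus> s \<otimes> b) (s \<otimes> t)"
proof -
  have "fraction R S (t' \<otimes> a' \<oplus> s' \<otimes> b') (s' \<otimes> t') = fraction R S (t \<otimes> a \<oplus> s \<otimes> b) (s \<otimes> t)"
    if c: "a' \<in> carrier R" "b' \<in> carrier R" "s' \<in> S" "t' \<in> S"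
      and eq: "fraction R S a s = fraction R S a' s'" "fraction R S b t = fraction R S b' t'"
    for a' b' s' t'
  proof -
    obtain u v where uv: "u \<in> S" "v \<in> S" "u \<otimes> (s' \<otimes> a \<ominus> s \<otimes> a') = \<zero>" "v \<otimes> (t' \<otimes> b \<ominus> t \<otimes> b') = \<zero>"
      using eq assms c by (auto simp: fraction_eq_iff)
    note car = assms(1,2) c(1,2) assms(3,4)[THEN S_carrier] c(3,4)[THEN S_carrier] uv(1,2)[THEN S_carrier]
    have "(u \<otimes> v) \<otimes> ((s' \<otimes> t') \<otimes> (t \<otimes> a \<oplus> s \<otimes> b) \<ominus> (s \<otimes> t) \<otimes> (t' \<otimes> a' \<oplus> s' \<otimes> b')) =
        v \<otimes> t \<otimes> t' \<otimes> (u \<otimes> (s' \<otimes> a \<ominus> s \<otimes> a')) \<oplus> u \<otimes> s \<otimes> s' \<otimes> (v \<otimes> (t' \<otimes> b \<ominus> t \<otimes> b'))"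
      using car by algebra
    also have "\<dots> = \<zero>" using car by (simp add: uv)
    finally have "fraction R S (t \<otimes> a \<oplus> s \<otimes> b) (s \<otimes> t) = fraction R S (t' \<otimes> a' \<oplus> s' \<otimes> b') (s' \<otimes> t')"
      using assms c uv S_carrier by (auto simp: fraction_eq_iff S_mult intro!: bexI[of _ "u \<otimes> v"])
    then show ?thesis ..
  qed
  then have "(\<Union>(a', s')\<in>fraction R S a s. \<Union>(b', t')\<in>fraction R S b t.
      fraction R S (t' \<otimes> a' \<oplus> s' \<otimes> b') (s' \<otimes> t')) = fraction R S (t \<otimes> a \<oplus> s \<otimes> b) (s \<otimes> t)"
    by (rule UN_fraction[OF assms])
  then show ?thesis by (simp only: localization_def ring.simps)
qed

lemma localization_one: "\<one>\<^bsub>localization R S\<^esub> = fraction R S \<one> \<one>"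
  and localization_zero: "\<zero>\<^bsub>localization R S\<^esub> = fraction R S \<zero> \<one>"
  by (simp_all add: localization_def)

proposition localization_cring: "cring (localization R S)"
proof (rule cringI)
  let ?L = "localization R S"
  have frac: "\<exists>a s. x = fraction R S a s \<and> a \<in> carrier R \<and> s \<in> S" if "x \<in> carrier ?L" for x
    using that by (auto simp: localization_carrier)
  show "abelian_group ?L"
  proof (rule abelian_groupI)
    fix x y assume "x \<in> carrier ?L" "y \<in> carrier ?L"
    then obtain a s b t where xy: "x = fraction R S a s" "y = fraction R S b t"
      and c: "a \<in> carrier R" "s \<in> S" "b \<in> carrier R" "t \<in> S"
      using frac by meson
    show "x \<oplus>\<^bsub>?L\<^esub> y \<in> carrier ?L"
      using c S_carrier by (simp add: xy fraction_add fraction_closed S_mult)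
    show "x \<oplus>\<^bsub>?L\<^esub> y = y \<oplus>\<^bsub>?L\<^esub> x"
      using c S_carrier by (simp add: xy fraction_add a_comm m_comm)
    fix z assume "z \<in> carrier ?L"
    then obtain d r where z: "z = fraction R S d r" and e: "d \<in> carrier R" "r \<in> S"
      using frac by meson
    note car = c(1,3) e(1) c(2,4)[THEN S_carrier] e(2)[THEN S_carrier]
    have "r \<otimes> (t \<otimes> a \<oplus> s \<otimes> b) \<oplus> (s \<otimes> t) \<otimes> d = (t \<otimes> r) \<otimes> a \<oplus> s \<otimes> (r \<otimes> b \<oplus> t \<otimes> d)"
      using car by algebra
    then show "x \<oplus>\<^bsub>?L\<^esub> y \<oplus>\<^bsub>?L\<^esub> z = x \<oplus>\<^bsub>?L\<^esub> (y \<oplus>\<^bsub>?L\<^esub> z)"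
      using c e car by (simp add: xy z fraction_add S_mult m_assoc)
  next
    fix x assume "x \<in> carrier ?L"
    then obtain a s where x: "x = fraction R S a s" and c: "a \<in> carrier R" "s \<in> S"
      using frac by meson
    show "\<zero>\<^bsub>?L\<^esub> \<oplus>\<^bsub>?L\<^esub> x = x"
      using c S_carrier S_one by (simp add: x localization_zero fraction_add)
    have "\<one> \<otimes> (s \<otimes> (\<ominus> a) \<oplus> s \<otimes> a) = (s \<otimes> s) \<otimes> \<zero>" using c S_carrier by algebra
    then have "fraction R S (\<ominus> a) s \<oplus>\<^bsub>?L\<^esub> x = \<zero>\<^bsub>?L\<^esub>"
      using c S_carrier S_one S_mult
      by (simp add: x localization_zero fraction_add) (rule fraction_eqI; simp)
    then show "\<exists>y\<in>carrier ?L. y \<oplus>\<^bsub>?L\<^esub> x = \<zero>\<^bsub>?L\<^esub>"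
      using c fraction_closed by blast
  qed (use S_one in \<open>auto simp: localization_zero fraction_closed\<close>)
  show "comm_monoid ?L"
  proof (rule comm_monoidI)
    fix x y assume "x \<in> carrier ?L" "y \<in> carrier ?L"
    then obtain a s b t where xy: "x = fraction R S a s" "y = fraction R S b t"
      and c: "a \<in> carrier R" "s \<in> S" "b \<in> carrier R" "t \<in> S"
      using frac by meson
    show "x \<otimes>\<^bsub>?L\<^esub> y \<in> carrier ?L"
      using c by (simp add: xy fraction_mult fraction_closed S_mult)
    show "x \<otimes>\<^bsub>?L\<^esub> y = y \<otimes>\<^bsub>?L\<^esub> x"
      using c S_carrier by (simp add: xy fraction_mult m_comm)
    fix z assume "z \<in> carrier ?L"
    then obtain d r where "z = fraction R S d r" "d \<in> carrier R" "r \<in> S"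
      using frac by meson
    then show "x \<otimes>\<^bsub>?L\<^esub> y \<otimes>\<^bsub>?L\<^esub> z = x \<otimes>\<^bsub>?L\<^esub> (y \<otimes>\<^bsub>?L\<^esub> z)"
      using c S_carrier by (simp add: xy fraction_mult S_mult m_assoc)
  next
    fix x assume "x \<in> carrier ?L"
    then obtain a s where "x = fraction R S a s" "a \<in> carrier R" "s \<in> S"
      using frac by meson
    then show "\<one>\<^bsub>?L\<^esub> \<otimes>\<^bsub>?L\<^esub> x = x"
      using S_carrier S_one by (simp add: localization_one fraction_mult)
  qed (use S_one in \<open>auto simp: localization_one fraction_closed\<close>)
  fix x y z assume "x \<in> carrier ?L" "y \<in> carrier ?L" "z \<in> carrier ?L"
  then obtain a s b t d r where xyz: "x = fraction R S a s" "y = fraction R S b t" "z = fraction R S d r"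
    and c: "a \<in> carrier R" "b \<in> carrier R" "d \<in> carrier R" "s \<in> S" "t \<in> S" "r \<in> S"
    using frac by meson
  note car = c(1-3) c(4-6)[THEN S_carrier]
  \<comment> \<open>The two sides differ by the factor \<open>r\<close> in numerator and denominator.\<close>
  have "((s \<otimes> r) \<otimes> (t \<otimes> r)) \<otimes> ((t \<otimes> a \<oplus> s \<otimes> b) \<otimes> d) =
      ((s \<otimes> t) \<otimes> r) \<otimes> ((t \<otimes> r) \<otimes> (a \<otimes> d) \<oplus> (s \<otimes> r) \<otimes> (b \<otimes> d))"
    using car by algebra
  then show "(x \<oplus>\<^bsub>?L\<^esub> y) \<otimes>\<^bsub>?L\<^esub> z = x \<otimes>\<^bsub>?L\<^esub> z \<oplus>\<^bsub>?L\<^esub> y \<otimes>\<^bsub>?L\<^esub> z"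
    using c car by (simp add: xyz fraction_add fraction_mult S_mult) (rule fraction_eqI; simp add: S_mult)
qed

end

section \<open>Powers of an ideal and cotangent functionals\<close>

context cring
begin

lemma ideal_power_0: "ideal_power R I 0 = carrier R"
  by (simp add: ideal_power_def ideals_set_def)

lemma ideal_power_Suc: "ideal_power R I (Suc k) = ideal_prod R (ideal_power R I k) I"
  by (simp add: ideal_power_def ideals_set_def)

lemma ideal_power_ideal: "ideal I R \<Longrightarrow> ideal (ideal_power R I k) R"
  by (induction k) (simp_all add: ideal_power_0 ideal_power_Suc oneideal ideal_prod_is_ideal)

lemma ideal_power_Suc_subset: "ideal I R \<Longrightarrow> ideal_power R I (Suc k) \<subseteq> I"
  using ideal_prod_inter[OF ideal_power_ideal] by (auto simp: ideal_power_Suc)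

lemma nat_pow_in_ideal_power:
  assumes "x \<in> I" shows "x [^] (k::nat) \<in> ideal_power R I k"
  using assms by (induction k) (auto simp: ideal_power_0 ideal_power_Suc intro: ideal_prod.prod)

lemma coset_eq_iff:
  assumes "ideal J R" "x \<in> carrier R" "y \<in> carrier R"
  shows "J +> x = J +> y \<longleftrightarrow> x \<ominus> y \<in> J"
proof -
  interpret ideal J R by fact
  show ?thesis
    using quotient_eq_iff_same_a_r_cos[OF assms] by simp
qed

lemma cotangent_simps:
  "carrier (cotangent R \<kappa> I n) = (\<lambda>x. ideal_power R I (Suc n) +> x) ` I"
  "C \<oplus>\<^bsub>cotangent R \<kappa> I n\<^esub> D = set_add R C D"
  "c \<odot>\<^bsub>cotangent R \<kappa> I n\<^esub> C =
     rcoset_mult R (ideal_power R I (Suc n)) (ideal_power R I (Suc n) +> \<kappa> c) C"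
  by (simp_all add: cotangent_def Let_def FactRing_def)

lemma dual_cotangent_zero:
  assumes "ideal I R" "\<phi> \<in> dual_space (cotangent R \<kappa> I n)"
  shows "\<phi> (ideal_power R I (Suc n) +> \<zero>) = 0"
proof -
  let ?J = "ideal_power R I (Suc n)"
  interpret J: ideal ?J R by (rule ideal_power_ideal[OF assms(1)])
  have "?J +> \<zero> \<in> carrier (cotangent R \<kappa> I n)"
    using additive_subgroup.zero_closed[OF ideal.axioms(1)[OF assms(1)]]
    by (simp add: cotangent_simps)
  then have "\<phi> (set_add R (?J +> \<zero>) (?J +> \<zero>)) = \<phi> (?J +> \<zero>) + \<phi> (?J +> \<zero>)"
    using assms(2) by (auto simp: dual_space_def cotangent_simps)
  then show ?thesis by (simp add: J.a_rcos_sum)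
qed

text \<open>
  Tangent functionals are constructed by descent: a linear function on \<open>I\<close> that vanishes on
  \<open>I\<^sup>n\<^sup>+\<^sup>1\<close> factors through the cotangent space.
\<close>

lemma dual_cotangentI:
  assumes I: "ideal I R" and \<kappa>: "\<And>c. \<kappa> c \<in> carrier R"
    and add: "\<And>x y. x \<in> I \<Longrightarrow> y \<in> I \<Longrightarrow> l (x \<oplus> y) = l x + l y"
    and smult: "\<And>c x. x \<in> I \<Longrightarrow> l (\<kappa> c \<otimes> x) = c * l x"
    and vanish: "\<And>x. x \<in> ideal_power R I (Suc n) \<Longrightarrow> l x = 0"
  shows "\<exists>\<phi>\<in>dual_space (cotangent R \<kappa> I n). \<forall>x\<in>I. \<phi> (ideal_power R I (Suc n) +> x) = l x"
proof -
  let ?J = "ideal_power R I (Suc n)" and ?V = "cotangent R \<kappa> I n"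
  interpret I: ideal I R by fact
  interpret J: ideal ?J R by (rule ideal_power_ideal[OF I])
  \<comment> \<open>The value on a coset is read off at an arbitrary representative; additivity of \<open>l\<close> and its vanishing make it independent of the choice.\<close>
  define \<phi> where "\<phi> = (\<lambda>C\<in>carrier ?V. l (SOME x. x \<in> I \<and> C = ?J +> x))"
  have \<phi>: "\<phi> (?J +> x) = l x" if x: "x \<in> I" for x
  proof -
    define y where "y = (SOME y. y \<in> I \<and> ?J +> x = ?J +> y)"
    have "\<exists>y. y \<in> I \<and> ?J +> x = ?J +> y" using x by blast
    then have y: "y \<in> I" "?J +> x = ?J +> y"
      unfolding y_def by (metis (mono_tags, lifting) someI_ex)+
    have "\<phi> (?J +> x) = l y" using x by (simp add: \<phi>_def y_def cotangent_simps)
    have "y = (y \<ominus> x) \<oplus> x" using x y I.Icarr by algebra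
    moreover have "y \<ominus> x \<in> ?J" using coset_eq_iff[OF J.is_ideal] x y I.Icarr by metis
    moreover from this have "y \<ominus> x \<in> I" using ideal_power_Suc_subset[OF I] by blast
    ultimately show ?thesis using add[of "y \<ominus> x" x] vanish x \<open>\<phi> (?J +> x) = l y\<close> by simp
  qed
  have "\<phi> \<in> dual_space ?V"
    unfolding dual_space_def
  proof (intro CollectI conjI ballI allI)
    show "\<phi> \<in> extensional (carrier ?V)" by (simp add: \<phi>_def)
    fix C assume "C \<in> carrier ?V"
    then obtain x where x: "x \<in> I" "C = ?J +> x" by (auto simp: cotangent_simps)
    show "\<phi> (c \<odot>\<^bsub>?V\<^esub> C) = c * \<phi> C" for c
      using x \<kappa> I.Icarr I.I_l_closed
      by (simp add: cotangent_simps J.rcoset_mult_add \<phi> smult)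
    fix D assume "D \<in> carrier ?V"
    then obtain y where "y \<in> I" "D = ?J +> y" by (auto simp: cotangent_simps)
    then show "\<phi> (C \<oplus>\<^bsub>?V\<^esub> D) = \<phi> C + \<phi> D"
      using x I.Icarr by (simp add: cotangent_simps J.a_rcos_sum \<phi> add)
  qed
  then show ?thesis using \<phi> by blast
qed

end

section \<open>The coordinate ring of a hypersurface\<close>

abbreviation cpoly_ring :: "'s cpoly ring" where
  "cpoly_ring \<equiv> class_ring"

lemma cpoly_ring_cring: "cring (cpoly_ring :: 's cpoly ring)"
proof (rule cringI)
  show "abelian_group (cpoly_ring :: 's cpoly ring)"
    by (rule abelian_groupI) (auto simp: add_ac intro: exI[of _ "- x" for x] )
  show "comm_monoid (cpoly_ring :: 's cpoly ring)"
    by (rule comm_monoidI) (auto simp: mult_ac)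
qed (auto simp: distrib_right)

lemma princ_ideal_iff: "f \<in> princ_ideal F \<longleftrightarrow> (\<exists>b. f = b * F)"
proof -
  have "princ_ideal F = cgenideal cpoly_ring F"
    unfolding princ_ideal_def by (rule cring.cgenideal_eq_genideal[OF cpoly_ring_cring, symmetric]) simp
  then show ?thesis by (auto simp: cgenideal_def)
qed

lemma princ_ideal_ideal: "ideal (princ_ideal F) cpoly_ring"
  unfolding princ_ideal_def
  by (rule ring.genideal_ideal[OF cring.axioms(1)[OF cpoly_ring_cring]]) simp

lemma cpoly_ring_uminus: "\<ominus>\<^bsub>cpoly_ring\<^esub> f = - (f :: 's cpoly)"
  by (rule abelian_group.minus_equality[OF ring.is_abelian_group[OF cring.axioms(1)[OF cpoly_ring_cring]]])
    simp_all

lemma cpoly_ring_minus: "f \<ominus>\<^bsub>cpoly_ring\<^esub> g = f - (g :: 's cpoly)"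
  by (simp add: a_minus_def cpoly_ring_uminus)

lemma coord_ring_cring: "cring (coord_ring F)"
  unfolding coord_ring_def
  by (rule ideal.quotient_is_cring[OF princ_ideal_ideal cpoly_ring_cring])

lemma residue_hom_ring: "ring_hom_ring cpoly_ring (coord_ring F) (residue F)"
  using ideal.rcos_ring_hom_ring[OF princ_ideal_ideal] by (simp add: residue_def[abs_def] coord_ring_def)

lemmas residue_hom = ring_hom_ring.homh[OF residue_hom_ring]

lemma residue_simps:
  "residue F f \<in> carrier (coord_ring F)"
  "residue F (f + g) = residue F f \<oplus>\<^bsub>coord_ring F\<^esub> residue F g"
  "residue F (f * g) = residue F f \<otimes>\<^bsub>coord_ring F\<^esub> residue F g"
  "residue F 1 = \<one>\<^bsub>coord_ring F\<^esub>"
  using ring_hom_closed[OF residue_hom] ring_hom_add[OF residue_hom] ring_hom_mult[OF residue_hom]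
    ring_hom_one[OF residue_hom] by simp_all

lemma residue_diff: "residue F (f - g) = residue F f \<ominus>\<^bsub>coord_ring F\<^esub> residue F g"
proof -
  interpret cring "coord_ring F" by (rule coord_ring_cring)
  have "(residue F (f - g) \<oplus>\<^bsub>coord_ring F\<^esub> residue F g) \<ominus>\<^bsub>coord_ring F\<^esub> residue F g = residue F (f - g)"
    using residue_simps(1)[of F "f - g"] residue_simps(1)[of F g] by algebra
  then show ?thesis by (simp flip: residue_simps)
qed

lemma residue_zero: "residue F 0 = \<zero>\<^bsub>coord_ring F\<^esub>"
  using residue_diff[of F 0 0] residue_simps(1)[of F 0]
  by (simp add: abelian_group.r_neg[OF ring.is_abelian_group[OF cring.axioms(1)[OF coord_ring_cring]]] a_minus_def)

lemma residue_surj: "x \<in> carrier (coord_ring F) \<Longrightarrow> \<exists>f. x = residue F f"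
  by (auto simp: coord_ring_def FactRing_simps residue_def A_RCOSETS_defs a_r_coset_def)

lemma residue_eq_zero_iff: "residue F f = \<zero>\<^bsub>coord_ring F\<^esub> \<longleftrightarrow> f \<in> princ_ideal F"
proof -
  have "residue F f = residue F 0 \<longleftrightarrow> f \<in> princ_ideal F"
    unfolding residue_def by (simp add: cring.coset_eq_iff[OF cpoly_ring_cring princ_ideal_ideal] cpoly_ring_minus)
  then show ?thesis by (simp add: residue_zero)
qed

section \<open>The local ring of a hypersurface at a point\<close>

locale hypersurface_point =
  fixes F :: "'s::finite cpoly" and p :: "'s \<Rightarrow> complex"
  assumes on_hypersurface: "cpoly_eval p F = 0"
begin

abbreviation frac :: "'s cpoly \<Rightarrow> 's cpoly \<Rightarrow> ('s cpoly set \<times> 's cpoly set) set" where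
  "frac f g \<equiv> fraction (coord_ring F) (denoms F p) (residue F f) (residue F g)"

lemma residue_eq_iff: "residue F f = residue F g \<longleftrightarrow> (\<exists>b. f - g = b * F)"
proof -
  interpret cring "coord_ring F" by (rule coord_ring_cring)
  have "residue F f = residue F g \<longleftrightarrow> residue F (f - g) = \<zero>\<^bsub>coord_ring F\<^esub>"
    by (simp add: residue_diff residue_simps)
  then show ?thesis by (simp add: residue_eq_zero_iff princ_ideal_iff)
qed

text \<open>
  As \<open>F(p) = 0\<close>, the value at \<open>p\<close> depends only on the residue class.
\<close>

lemma residue_in_denoms_iff: "residue F g \<in> denoms F p \<longleftrightarrow> cpoly_eval p g \<noteq> 0"
proof -
  have "residue F g \<in> coord_ideal F p \<longleftrightarrow> cpoly_eval p g = 0"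
  proof
    assume "residue F g \<in> coord_ideal F p"
    then obtain f b where f: "cpoly_eval p f = 0" "g - f = b * F"
      by (auto simp: coord_ideal_def point_ideal_def residue_eq_iff)
    then have "g = f + b * F" by (simp add: algebra_simps)
    then show "cpoly_eval p g = 0" using f on_hypersurface by simp
  qed (auto simp: coord_ideal_def point_ideal_def)
  then show ?thesis by (simp add: denoms_def residue_simps)
qed

lemma in_denomsE:
  assumes "s \<in> denoms F p"
  obtains g where "s = residue F g" "cpoly_eval p g \<noteq> 0"
  using assms residue_surj[of s F] residue_in_denoms_iff by (auto simp: denoms_def)

sublocale denoms: multiplicative_subset "coord_ring F" "denoms F p"
proof (intro multiplicative_subset.intro coord_ring_cring multiplicative_subset_axioms.intro)
  show "denoms F p \<subseteq> carrier (coord_ring F)" by (auto simp: denoms_def)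
  show "\<one>\<^bsub>coord_ring F\<^esub> \<in> denoms F p"
    using residue_in_denoms_iff[of 1] by (simp add: residue_simps)
  show "s \<otimes>\<^bsub>coord_ring F\<^esub> t \<in> denoms F p" if "s \<in> denoms F p" "t \<in> denoms F p" for s t
    using that by (auto elim!: in_denomsE simp: residue_in_denoms_iff simp flip: residue_simps)
qed

sublocale L: cring "local_ring F p"
  unfolding local_ring_def by (rule denoms.localization_cring)

lemma frac_eq_iff:
  assumes "cpoly_eval p g \<noteq> 0" "cpoly_eval p g' \<noteq> 0"
  shows "frac f g = frac f' g' \<longleftrightarrow> (\<exists>u b. cpoly_eval p u \<noteq> 0 \<and> u * (g' * f - g * f') = b * F)"
proof -
  have "frac f g = frac f' g' \<longleftrightarrow> (\<exists>s\<in>denoms F p. s \<otimes>\<^bsub>coord_ring F\<^esub>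
      (residue F g' \<otimes>\<^bsub>coord_ring F\<^esub> residue F f \<ominus>\<^bsub>coord_ring F\<^esub> residue F g \<otimes>\<^bsub>coord_ring F\<^esub> residue F f')
      = \<zero>\<^bsub>coord_ring F\<^esub>)"
    using assms by (intro denoms.fraction_eq_iff) (simp_all add: residue_simps residue_in_denoms_iff)
  also have "\<dots> \<longleftrightarrow> (\<exists>u. cpoly_eval p u \<noteq> 0 \<and> residue F (u * (g' * f - g * f')) = \<zero>\<^bsub>coord_ring F\<^esub>)"
    by (auto simp: residue_in_denoms_iff residue_simps residue_diff elim!: in_denomsE)
  finally show ?thesis by (simp add: residue_eq_zero_iff princ_ideal_iff)
qed

lemma frac_closed: "cpoly_eval p g \<noteq> 0 \<Longrightarrow> frac f g \<in> carrier (local_ring F p)"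
  by (simp add: local_ring_def denoms.fraction_closed residue_simps residue_in_denoms_iff)

lemma in_local_ringE:
  assumes "x \<in> carrier (local_ring F p)"
  obtains f g where "x = frac f g" "cpoly_eval p g \<noteq> 0"
  using assms residue_surj[of _ F]
  by (auto simp: local_ring_def denoms.localization_carrier elim!: in_denomsE) (metis)

lemma frac_add:
  assumes "cpoly_eval p g \<noteq> 0" "cpoly_eval p g' \<noteq> 0"
  shows "frac f g \<oplus>\<^bsub>local_ring F p\<^esub> frac f' g' = frac (g' * f + g * f') (g * g')"
  using assms by (simp add: local_ring_def denoms.fraction_add residue_simps residue_in_denoms_iff)

lemma frac_mult:
  assumes "cpoly_eval p g \<noteq> 0" "cpoly_eval p g' \<noteq> 0"
  shows "frac f g \<otimes>\<^bsub>local_ring F p\<^esub> frac f' g' = frac (f * f') (g * g')"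
  using assms by (simp add: local_ring_def denoms.fraction_mult residue_simps residue_in_denoms_iff)

lemma germ_eq: "germ F p f = frac f 1"
  by (simp add: germ_def residue_simps)

lemma frac_eqI:
  assumes "cpoly_eval p g \<noteq> 0" "cpoly_eval p g' \<noteq> 0" "g' * f = g * f'"
  shows "frac f g = frac f' g'"
  unfolding frac_eq_iff[OF assms(1,2)] using assms(3) by (intro exI[of _ 1] exI[of _ 0]) simp

lemma germ_closed: "germ F p f \<in> carrier (local_ring F p)"
  by (simp add: germ_eq frac_closed)

lemma germ_one: "germ F p 1 = \<one>\<^bsub>local_ring F p\<^esub>"
  by (simp add: germ_eq local_ring_def denoms.localization_one residue_simps)

lemma frac_zero: "cpoly_eval p g \<noteq> 0 \<Longrightarrow> frac 0 g = \<zero>\<^bsub>local_ring F p\<^esub>"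
  using frac_eqI[of g 1 0 0]
  by (simp add: local_ring_def denoms.localization_zero residue_simps residue_zero)

lemma frac_uminus:
  assumes "cpoly_eval p g \<noteq> 0"
  shows "\<ominus>\<^bsub>local_ring F p\<^esub> frac f g = frac (- f) g"
  using assms by (intro L.minus_equality) (simp_all add: frac_add frac_closed frac_zero)

lemma frac_diff:
  assumes "cpoly_eval p g \<noteq> 0" "cpoly_eval p g' \<noteq> 0"
  shows "frac f g \<ominus>\<^bsub>local_ring F p\<^esub> frac f' g' = frac (g' * f - g * f') (g * g')"
  using assms by (simp add: a_minus_def frac_uminus frac_add)

lemma germ_ring_hom:
  "germ F p (f + g) = germ F p f \<oplus>\<^bsub>local_ring F p\<^esub> germ F p g"
  "germ F p (f - g) = germ F p f \<ominus>\<^bsub>local_ring F p\<^esub> germ F p g"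
  "germ F p (f * g) = germ F p f \<otimes>\<^bsub>local_ring F p\<^esub> germ F p g"
  by (simp_all add: germ_eq frac_add frac_diff frac_mult)

lemma germ_power: "germ F p (f ^ k) = germ F p f [^]\<^bsub>local_ring F p\<^esub> k"
  by (induction k) (simp_all add: germ_one germ_ring_hom germ_closed L.m_comm)

lemma germ_multiple: "germ F p (b * F) = \<zero>\<^bsub>local_ring F p\<^esub>"
proof -
  have "\<exists>u c. cpoly_eval p u \<noteq> 0 \<and> u * (1 * (b * F) - 1 * 0) = c * F"
    by (rule exI[of _ 1], rule exI[of _ b]) simp
  then have "germ F p (b * F) = frac 0 1"
    unfolding germ_eq using frac_eq_iff[of 1 1 "b * F" 0] by (metis cpoly_eval_1 one_neq_zero)
  then show ?thesis by (simp add: frac_zero)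
qed

lemma local_ideal_eq:
  "local_ideal F p = {frac f g | f g. cpoly_eval p f = 0 \<and> cpoly_eval p g \<noteq> 0}"
proof (intro subset_antisym subsetI)
  fix x assume "x \<in> local_ideal F p"
  then obtain a s where x: "x = fraction (coord_ring F) (denoms F p) a s" "a \<in> coord_ideal F p" "s \<in> denoms F p"
    unfolding local_ideal_def by blast
  then obtain f where "a = residue F f" "cpoly_eval p f = 0"
    by (auto simp: coord_ideal_def point_ideal_def)
  moreover obtain g where "s = residue F g" "cpoly_eval p g \<noteq> 0"
    using x(3) by (rule in_denomsE)
  ultimately show "x \<in> {frac f g | f g. cpoly_eval p f = 0 \<and> cpoly_eval p g \<noteq> 0}"
    using x(1) by blast
next
  fix x assume "x \<in> {frac f g | f g. cpoly_eval p f = 0 \<and> cpoly_eval p g \<noteq> 0}"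
  then obtain f g where x: "x = frac f g" "cpoly_eval p f = 0" "cpoly_eval p g \<noteq> 0" by blast
  moreover from this have "residue F f \<in> coord_ideal F p" "residue F g \<in> denoms F p"
    by (auto simp: coord_ideal_def point_ideal_def residue_in_denoms_iff)
  ultimately show "x \<in> local_ideal F p"
    unfolding local_ideal_def by blast
qed

lemma germ_in_local_ideal: "f \<in> point_ideal p \<Longrightarrow> germ F p f \<in> local_ideal F p"
  unfolding local_ideal_eq germ_eq point_ideal_def using cpoly_eval_1[of p] by fastforce

lemma local_ideal_ideal: "ideal (local_ideal F p) (local_ring F p)"
proof (rule idealI)
  let ?m = "local_ideal F p" and ?L = "local_ring F p"
  have in_m: "frac f g \<in> ?m" if "cpoly_eval p f = 0" "cpoly_eval p g \<noteq> 0" for f g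
    using that by (auto simp: local_ideal_eq)
  show "ring ?L" by (rule L.ring_axioms)
  show "subgroup ?m (add_monoid ?L)"
  proof (rule L.add.subgroupI)
    show "?m \<subseteq> carrier ?L" by (auto simp: local_ideal_eq frac_closed)
    show "?m \<noteq> {}" using in_m[of 0 1] by auto
    show "\<ominus>\<^bsub>?L\<^esub> x \<in> ?m" if "x \<in> ?m" for x
      using that in_m by (auto simp: local_ideal_eq frac_uminus)
    show "x \<oplus>\<^bsub>?L\<^esub> y \<in> ?m" if xy: "x \<in> ?m" "y \<in> ?m" for x y
    proof -
      obtain f g f' g' where "x = frac f g" "y = frac f' g'" "cpoly_eval p f = 0" "cpoly_eval p f' = 0"
        "cpoly_eval p g \<noteq> 0" "cpoly_eval p g' \<noteq> 0"
        using xy by (auto simp: local_ideal_eq)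
      then show ?thesis by (simp add: frac_add in_m)
    qed
  qed
  fix x y assume x: "x \<in> ?m" and y: "y \<in> carrier ?L"
  obtain f g f' g' where "x = frac f g" "y = frac f' g'" "cpoly_eval p f = 0"
    "cpoly_eval p g \<noteq> 0" "cpoly_eval p g' \<noteq> 0"
    using x y by (auto simp: local_ideal_eq elim!: in_local_ringE)
  then show "y \<otimes>\<^bsub>?L\<^esub> x \<in> ?m" "x \<otimes>\<^bsub>?L\<^esub> y \<in> ?m" by (simp_all add: frac_mult in_m)
qed

text \<open>
  A product in \<open>\<mm>\<^sup>k \<mm>\<close> multiplies the numerators, so their orders add, and bringing a sum to a common
  denominator multiplies each numerator by a polynomial, which does not lower its order.
\<close>

lemma local_ideal_power_numerator:
  assumes "x \<in> ideal_power (local_ring F p) (local_ideal F p) k"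
  shows "\<exists>f g. x = frac f g \<and> f \<in> order_ideal p k \<and> cpoly_eval p g \<noteq> 0"
  using assms
proof (induction k arbitrary: x)
  case 0
  then show ?case by (auto simp: L.ideal_power_0 elim!: in_local_ringE)
next
  case (Suc k)
  from Suc.prems show ?case unfolding L.ideal_power_Suc
  proof (induction rule: ideal_prod.induct)
    case (prod x y)
    obtain f g where x: "x = frac f g" "f \<in> order_ideal p k" "cpoly_eval p g \<noteq> 0"
      using Suc.IH[OF prod(1)] by blast
    obtain f' g' where y: "y = frac f' g'" "f' \<in> point_ideal p" "cpoly_eval p g' \<noteq> 0"
      using prod(2) by (auto simp: local_ideal_eq point_ideal_def)
    have "f * f' \<in> order_ideal p (Suc k)"
      using order_ideal_mult[of f p k f' 1] x y order_ideal_1[of p] by simp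
    then show ?case using x y
      by (intro exI[of _ "f * f'"] exI[of _ "g * g'"]) (simp add: frac_mult)
  next
    case (sum x y)
    then obtain f g f' g' where "x = frac f g" "f \<in> order_ideal p (Suc k)" "cpoly_eval p g \<noteq> 0"
      "y = frac f' g'" "f' \<in> order_ideal p (Suc k)" "cpoly_eval p g' \<noteq> 0"
      by blast
    then show ?case
      by (intro exI[of _ "g' * f + g * f'"] exI[of _ "g * g'"])
        (simp add: frac_add order_ideal_add order_ideal_times)
  qed
qed

text \<open>
  If the germ of \<open>f\<close> lies in \<open>\<mm>\<^sup>k\<close>, then clearing denominators gives \<open>w f \<in> \<aa>\<^sup>k + \<langle>F\<rangle>\<close> for some \<open>w\<close>
  with \<open>w(p) \<noteq> 0\<close>. Modulo \<open>\<aa>\<^sup>k\<close> such a \<open>w\<close> is invertible, so \<open>f\<close> itself lies in \<open>\<aa>\<^sup>k + \<langle>F\<rangle>\<close>.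
\<close>

proposition germ_in_local_ideal_powerD:
  assumes "germ F p f \<in> ideal_power (local_ring F p) (local_ideal F p) k"
  shows "\<exists>a\<in>order_ideal p k. \<exists>b. f = a + b * F"
proof -
  obtain a g where a: "frac f 1 = frac a g" "a \<in> order_ideal p k" and g: "cpoly_eval p g \<noteq> 0"
    using local_ideal_power_numerator[OF assms] by (auto simp: germ_eq)
  then obtain u b where u: "cpoly_eval p u \<noteq> 0" "u * (g * f - a) = b * F"
    using frac_eq_iff[of 1 g f a] by auto
  obtain h v where v: "v \<in> point_ideal p" "(u * g) * h = 1 - v ^ k"
    using inverse_modulo_order_ideal[of p "u * g"] u(1) g by (metis cpoly_eval_simps(5) mult_eq_0_iff)
  \<comment> \<open>Multiply by \<open>1 = (u g) h + v\<^sup>k\<close>: the first part of \<open>f\<close> is controlled by the fraction, the second has order \<open>k\<close>.\<close>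
  have "f = ((u * g) * h + v ^ k) * f" by (simp add: v)
  also have "\<dots> = (h * (u * a) + f * v ^ k) + (h * b) * F"
  proof -
    have "u * g * f = u * a + b * F" using u(2) by (simp add: algebra_simps)
    then have "h * (u * g * f) = h * (u * a) + h * b * F" by (simp add: algebra_simps)
    then show ?thesis by (simp add: algebra_simps)
  qed
  finally show ?thesis
    using a v(1) by (meson order_ideal_add order_ideal_times point_ideal_power)
qed

text \<open>
  Every element of \<open>\<mm>\<close> is a polynomial germ up to \<open>\<mm>\<^sup>k\<close>: replace the inverse of the denominator by its
  truncated geometric series.
\<close>

lemma local_ideal_approx:
  assumes "x \<in> local_ideal F p"
  shows "\<exists>f\<in>point_ideal p. x \<ominus>\<^bsub>local_ring F p\<^esub> germ F p f \<in> ideal_power (local_ring F p) (local_ideal F p) k"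
proof -
  let ?mk = "ideal_power (local_ring F p) (local_ideal F p) k"
  interpret mk: ideal ?mk "local_ring F p" by (rule L.ideal_power_ideal[OF local_ideal_ideal])
  obtain f g where x: "x = frac f g" "cpoly_eval p f = 0" "cpoly_eval p g \<noteq> 0"
    using assms by (auto simp: local_ideal_eq)
  obtain h u where u: "u \<in> point_ideal p" "g * h = 1 - u ^ k"
    by (rule inverse_modulo_order_ideal[OF x(3)])
  \<comment> \<open>The error of the approximation is \<open>f (1 - g h) / g = u\<^sup>k f / g\<close>.\<close>
  have "x \<ominus>\<^bsub>local_ring F p\<^esub> germ F p (f * h) = frac (u ^ k * f) g"
  proof -
    have "f - g * (f * h) = f * (1 - g * h)" by (simp add: algebra_simps)
    then show ?thesis using x by (simp add: germ_eq frac_diff u(2) mult.commute)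
  qed
  also have "\<dots> = germ F p u [^]\<^bsub>local_ring F p\<^esub> k \<otimes>\<^bsub>local_ring F p\<^esub> frac f g"
    using x by (simp add: germ_eq[of "u ^ k"] frac_mult flip: germ_power)
  also have "\<dots> \<in> ?mk"
    using x by (intro mk.I_r_closed L.nat_pow_in_ideal_power germ_in_local_ideal u(1) frac_closed)
  finally show ?thesis using x by (intro bexI[of _ "f * h"]) (auto simp: point_ideal_def)
qed

end

section \<open>Tangent functionals\<close>

lemma point_ideal_ideal: "ideal (point_ideal p) (cpoly_ring :: 's::finite cpoly ring)"
proof (rule idealI)
  let ?P = "cpoly_ring :: 's cpoly ring"
  show "ring ?P" by (rule cring.axioms(1)[OF cpoly_ring_cring])
  show "subgroup (point_ideal p) (add_monoid ?P)"
  proof (rule group.subgroupI)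
    show "group (add_monoid ?P)"
      by (rule abelian_group.a_group[OF ring.is_abelian_group[OF cring.axioms(1)[OF cpoly_ring_cring]]])
    show "point_ideal p \<noteq> {}" using cpoly_eval_simps(1)[of p] unfolding point_ideal_def by blast
    show "inv\<^bsub>add_monoid ?P\<^esub> f \<in> point_ideal p" if "f \<in> point_ideal p" for f
      using that cpoly_ring_uminus[of f] by (simp add: a_inv_def point_ideal_def)
  qed (auto simp: point_ideal_def)
qed (auto simp: point_ideal_def)

lemma point_ideal_power_subset: "ideal_power cpoly_ring (point_ideal p) k \<subseteq> order_ideal p k"
proof (induction k)
  case (Suc k)
  show ?case
  proof
    fix f assume "f \<in> ideal_power cpoly_ring (point_ideal p) (Suc k)"
    then have "f \<in> ideal_prod cpoly_ring (ideal_power cpoly_ring (point_ideal p) k) (point_ideal p)"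
      by (simp add: cring.ideal_power_Suc[OF cpoly_ring_cring])
    then show "f \<in> order_ideal p (Suc k)"
    proof (induction rule: ideal_prod.induct)
      case (prod f g)
      then have "f * g \<in> order_ideal p (k + 1)"
        using Suc by (intro order_ideal_mult) (auto simp: order_ideal_1 simp del: One_nat_def)
      then show ?case by simp
    qed (simp add: order_ideal_add)
  qed
qed simp

text \<open>
  A linear function on polynomials that vanishes on \<open>\<aa>\<^sup>n\<^sup>+\<^sup>1\<close> and on the multiples of \<open>F\<close> descends to
  both cotangent spaces. On \<open>\<mm>\<close> it is evaluated through a polynomial approximating the given germ
  modulo \<open>\<mm>\<^sup>n\<^sup>+\<^sup>1\<close>; two such polynomials differ by an element of \<open>\<aa>\<^sup>n\<^sup>+\<^sup>1 + \<langle>F\<rangle>\<close>.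
\<close>

lemma (in hypersurface_point) tangent_functionals:
  fixes l :: "'s cpoly \<Rightarrow> complex"
  assumes add: "\<And>f g. l (f + g) = l f + l g"
    and smult: "\<And>c f. l (cpoly_const c * f) = c * l f"
    and vanish: "\<And>f. f \<in> order_ideal p (Suc n) \<Longrightarrow> l f = 0"
    and multiples: "\<And>b. l (b * F) = 0"
  shows "\<exists>\<psi>\<in>tangent_affine n p. \<exists>\<phi>\<in>tangent_hypersurface n F p. \<forall>f\<in>point_ideal p.
    \<psi> (affine_class n p f) = l f \<and> \<phi> (local_class n F p f) = l f"
proof -
  let ?L = "local_ring F p" and ?m = "local_ideal F p"
  let ?J = "ideal_power ?L ?m (Suc n)"
  interpret m: ideal ?m ?L by (rule local_ideal_ideal)
  interpret J: ideal ?J ?L by (rule L.ideal_power_ideal[OF local_ideal_ideal])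
  have "\<exists>\<psi>\<in>tangent_affine n p. \<forall>f\<in>point_ideal p. \<psi> (affine_class n p f) = l f"
    unfolding tangent_affine_def affine_class_def
  proof (rule cring.dual_cotangentI[OF cpoly_ring_cring point_ideal_ideal[of p],
        where l = l and n = n and \<kappa> = cpoly_const])
    show "l x = 0" if "x \<in> ideal_power cpoly_ring (point_ideal p) (Suc n)" for x
      using that point_ideal_power_subset vanish by blast
  qed (simp_all add: add smult)
  then obtain \<psi> where \<psi>: "\<psi> \<in> tangent_affine n p"
    "\<And>f. f \<in> point_ideal p \<Longrightarrow> \<psi> (affine_class n p f) = l f"
    by blast

  have diff: "l (f - g) = l f - l g" for f g
    using add[of "f - g" g] by simp
  have germ_unique: "l f = l g" if "germ F p f \<ominus>\<^bsub>?L\<^esub> germ F p g \<in> ?J" for f g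
  proof -
    have "germ F p (f - g) \<in> ?J" using that by (simp add: germ_ring_hom)
    then obtain a b where "a \<in> order_ideal p (Suc n)" "f - g = a + b * F"
      using germ_in_local_ideal_powerD by blast
    then have "l (f - g) = 0" by (simp add: add vanish multiples)
    then show ?thesis by (simp add: diff)
  qed
  define l' where "l' x = l (SOME f. f \<in> point_ideal p \<and> x \<ominus>\<^bsub>?L\<^esub> germ F p f \<in> ?J)" for x
  \<comment> \<open>Any approximating polynomial computes \<open>l'\<close>, so linearity can be checked on convenient ones.\<close>
  have l': "l' x = l f" if x: "x \<in> ?m" and f: "x \<ominus>\<^bsub>?L\<^esub> germ F p f \<in> ?J" for x f
  proof -
    define g where "g = (SOME f. f \<in> point_ideal p \<and> x \<ominus>\<^bsub>?L\<^esub> germ F p f \<in> ?J)"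
    have "\<exists>f. f \<in> point_ideal p \<and> x \<ominus>\<^bsub>?L\<^esub> germ F p f \<in> ?J"
      using local_ideal_approx[OF x] by blast
    then have g: "x \<ominus>\<^bsub>?L\<^esub> germ F p g \<in> ?J"
      unfolding g_def by (metis (mono_tags, lifting) someI_ex)
    have "germ F p g \<ominus>\<^bsub>?L\<^esub> germ F p f =
        (x \<ominus>\<^bsub>?L\<^esub> germ F p f) \<ominus>\<^bsub>?L\<^esub> (x \<ominus>\<^bsub>?L\<^esub> germ F p g)"
      using m.Icarr[OF x] germ_closed[of f] germ_closed[of g] by algebra
    also have "\<dots> \<in> ?J" using f g by (simp add: a_minus_def)
    finally show ?thesis using germ_unique by (simp add: l'_def flip: g_def)
  qed
  have "\<exists>\<phi>\<in>tangent_hypersurface n F p. \<forall>x\<in>?m. \<phi> (?J +>\<^bsub>?L\<^esub> x) = l' x"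
    unfolding tangent_hypersurface_def
  proof (rule L.dual_cotangentI[OF local_ideal_ideal, where l = l' and n = n])
    show "germ F p (cpoly_const c) \<in> carrier ?L" for c by (rule germ_closed)
    show "l' (x \<oplus>\<^bsub>?L\<^esub> y) = l' x + l' y" if xy: "x \<in> ?m" "y \<in> ?m" for x y
    proof -
      obtain f g where fg: "x \<ominus>\<^bsub>?L\<^esub> germ F p f \<in> ?J" "y \<ominus>\<^bsub>?L\<^esub> germ F p g \<in> ?J"
        using xy local_ideal_approx by meson
      have "(x \<oplus>\<^bsub>?L\<^esub> y) \<ominus>\<^bsub>?L\<^esub> germ F p (f + g) =
          (x \<ominus>\<^bsub>?L\<^esub> germ F p f) \<oplus>\<^bsub>?L\<^esub> (y \<ominus>\<^bsub>?L\<^esub> germ F p g)"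
        unfolding germ_ring_hom
        using xy[THEN m.Icarr] germ_closed[of f] germ_closed[of g] by algebra
      also have "\<dots> \<in> ?J" using fg by simp
      finally show ?thesis using xy fg by (simp add: l'[of _ "f + g"] l'[of x f] l'[of y g] add)
    qed
    show "l' (germ F p (cpoly_const c) \<otimes>\<^bsub>?L\<^esub> x) = c * l' x" if x: "x \<in> ?m" for c x
    proof -
      obtain f where f: "x \<ominus>\<^bsub>?L\<^esub> germ F p f \<in> ?J"
        using x local_ideal_approx by meson
      have "germ F p (cpoly_const c) \<otimes>\<^bsub>?L\<^esub> x \<ominus>\<^bsub>?L\<^esub> germ F p (cpoly_const c * f) =
          germ F p (cpoly_const c) \<otimes>\<^bsub>?L\<^esub> (x \<ominus>\<^bsub>?L\<^esub> germ F p f)"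
        unfolding germ_ring_hom
        using x[THEN m.Icarr] germ_closed[of f] germ_closed[of "cpoly_const c"] by algebra
      also have "\<dots> \<in> ?J" using f by (simp add: J.I_l_closed germ_closed)
      finally show ?thesis
        using x f by (simp add: l'[of _ "cpoly_const c * f"] l'[of x f] smult m.I_l_closed germ_closed)
    qed
    show "l' x = 0" if x: "x \<in> ?J" for x
    proof -
      have "x \<ominus>\<^bsub>?L\<^esub> germ F p (0 * F) \<in> ?J"
        unfolding germ_multiple using x J.Icarr[OF x] by (simp add: a_minus_def)
      then have "l' x = l (0 * F)"
        using x L.ideal_power_Suc_subset[OF local_ideal_ideal] by (intro l') auto
      then show ?thesis by (simp only: multiples)
    qed
  qed
  then obtain \<phi> where \<phi>: "\<phi> \<in> tangent_hypersurface n F p"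
    "\<And>x. x \<in> ?m \<Longrightarrow> \<phi> (?J +>\<^bsub>?L\<^esub> x) = l' x"
    by blast
  have "\<phi> (local_class n F p f) = l f" if f: "f \<in> point_ideal p" for f
  proof -
    have "germ F p f \<ominus>\<^bsub>?L\<^esub> germ F p f \<in> ?J"
      using germ_closed[of f] by (simp add: L.r_neg a_minus_def)
    then show ?thesis
      using f by (simp add: local_class_def \<phi>(2) germ_in_local_ideal l'[of _ f])
  qed
  then show ?thesis using \<psi> \<phi>(1) by blast
qed

theorem proposition3p3:
  fixes F :: "'s::{finite,linorder} cpoly" and p :: "'s \<Rightarrow> complex" and n :: nat
  assumes "n \<ge> 1"
    and "p \<in> hypersurface F"
    and "nonsingular_point F p"
  shows "tangent_coords n F p = mat_kernel (Jac_at n F p)"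
proof -
  have F: "cpoly_eval p F = 0" using assms(2) by (simp add: hypersurface_def)
  interpret hypersurface_point F p by standard (rule F)
  have "t \<in> tangent_coords n F p \<longleftrightarrow> t \<in> carrier_vec (((n + CARD('s)) choose CARD('s)) - 1) \<and>
      (\<forall>b. t \<bullet> taylor n p (b * F) = 0)" for t
  proof (intro iffI conjI allI)
    assume t: "t \<in> tangent_coords n F p"
    then show "t \<in> carrier_vec (((n + CARD('s)) choose CARD('s)) - 1)"
      by (simp add: tangent_coords_def)
    fix b
    obtain \<psi> \<phi> where "\<phi> \<in> tangent_hypersurface n F p"
      and eq: "\<forall>f\<in>point_ideal p. \<psi> (affine_class n p f) = t \<bullet> taylor n p f"
        "\<forall>f\<in>point_ideal p. \<psi> (affine_class n p f) = \<phi> (local_class n F p f)"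
      using t by (auto simp: tangent_coords_def)
    then have "\<phi> (local_class n F p (b * F)) = 0"
      using L.dual_cotangent_zero[OF local_ideal_ideal]
      by (auto simp: tangent_hypersurface_def local_class_def germ_multiple)
    then show "t \<bullet> taylor n p (b * F) = 0"
      using eq F by (metis (mono_tags, lifting) cpoly_eval_simps(5) mem_Collect_eq mult_zero_right point_ideal_def)
  next
    assume t: "t \<in> carrier_vec (((n + CARD('s)) choose CARD('s)) - 1) \<and>
      (\<forall>b. t \<bullet> taylor n p (b * F) = 0)"
    have "\<exists>\<psi>\<in>tangent_affine n p. \<exists>\<phi>\<in>tangent_hypersurface n F p. \<forall>f\<in>point_ideal p.
        \<psi> (affine_class n p f) = t \<bullet> taylor n p f \<and> \<phi> (local_class n F p f) = t \<bullet> taylor n p f"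
      using t by (intro tangent_functionals) (simp_all add: scalar_prod_taylor_simps scalar_prod_taylor_order_ideal)
    then obtain \<psi> \<phi> where "\<psi> \<in> tangent_affine n p" "\<phi> \<in> tangent_hypersurface n F p"
      and "\<forall>f\<in>point_ideal p. \<psi> (affine_class n p f) = t \<bullet> taylor n p f"
        "\<forall>f\<in>point_ideal p. \<phi> (local_class n F p f) = t \<bullet> taylor n p f"
      by blast
    then show "t \<in> tangent_coords n F p"
      using t unfolding tangent_coords_def
      by (intro CollectI conjI bexI[of _ \<psi>] bexI[of _ \<phi>]) simp_all
  qed
  then show ?thesis
    using mat_kernel_Jac_at_iff[OF assms(1) F] by (auto intro: subset_antisym)
qed

end
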